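(* Let $\bar\mu\in\mathcal{M}(\Omega)$ be given. Let $\bar\nu\in\mathcal{M}(\Omega)$ with $\bar\nu(\Omega)=0$ and $\bar\gamma\in\Pi(\bar\nu_+,\bar\nu_-)$ be such that $$\|\bar\mu\|_{\mathrm{KR}_p^{\alpha,\beta}}=\mathcal{W}_p^\beta(\bar\nu)+\alpha|\bar\mu-\bar\nu|(\Omega)\quad\text{and}\quad W_p(\bar\nu_+,\bar\nu_-)=\int_{\Omega\times\Omega}|x-y|^p\,d\bar\gamma(x,y).$$ Set $\bar q:=-K_*\nabla F(K\bar\mu)$ and $\Psi_{\bar q}(x,y):=\dfrac{\bar q(x)-\bar q(y)}{|x-y|^p+\beta}$ for all $(x,y)\in\Omega\times\Omega$. The following statements are equivalent: 1. The measure $\bar\mu$ is a solution of $\inf_{\mu\in\mathcal{M}(\Omega)}J(\mu)$, where $J(\mu)=F(K\mu)+\|\mu\|_{\mathrm{KR}_p^{\alpha,\beta}}$. 2. $\bar q\in\partial\|\bar\mu\|_{\mathrm{KR}_p^{\alpha,\beta}}$. 3. $|\bar q(x)|\le\alpha$ and $\Psi_{\bar q}(x,y)\le1$ for all $x,y\in\Omega$, and moreover $$\operatorname{supp}(\bar\mu-\bar\nu)^{\pm}\subset\{x\in\Omega:\bar q(x)=\pm\alpha\},\qquad \operatorname{supp}\bar\gamma\subset\{(x,y)\in\Omega\times\Omega:\Psi_{\bar q}(x,y)=1\}.$$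
   Context: Standing assumptions: $\Omega\subset\mathbb{R}^n$ is convex and compact, $p\in(0,1]$, $\alpha>0$, $\beta>0$, $2\alpha-\beta>0$. $\mathcal{M}(\Omega)=\mathcal{C}(\Omega)^*$ is the space of finite signed Radon measures; $\nu_\pm=\nu^\pm$ are the positive/negative parts of $\nu$ and $|\nu|$ its total variation measure. $Y$ is a Hilbert space, $K:\mathcal{M}(\Omega)\to Y$ is linear and weak*-to-strong continuous, $F:Y\to\mathbb{R}$ is strictly convex, Fr\'echet differentiable, and $\nabla F$ is Lipschitz continuous on compact sets. $K_*:Y\to\mathcal{C}(\Omega)$ is the pre-adjoint of $K$: $\langle K_*v,\mu\rangle=(v,K\mu)_Y$. For nonnegative measures, $W_p(\mu,\nu):=\inf\{\int|x-y|^p\,d\gamma:\gamma\in\Pi(\mu,\nu)\}$ (no $1/p$-th power), with $\Pi(\mu,\nu)$ the set of nonnegative measures on $\Omega\times\Omega$ with marginals $\mu$ and $\nu$. $\mathcal{W}_p^\beta(\nu):=W_p(\nu_+,\nu_-)+\frac\beta2|\nu|(\Omega)+\mathbf{1}_{\nu(\Omega)=0}$, with $\mathbf{1}_{\nu(\Omega)=0}$ equal to $0$ if $\nu(\Omega)=0$ and $+\infty$ otherwise. $\|\mu\|_{\mathrm{KR}_p^{\alpha,\beta}}:=\inf_{\nu\in\mathcal{M}(\Omega)}\mathcal{W}_p^\beta(\nu)+\alpha|\mu-\nu|(\Omega)$. $\partial\|\bar\mu\|_{\mathrm{KR}_p^{\alpha,\beta}}$ is the convex subdifferential of this norm at $\bar\mu$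 (with respect to the pairing of $\mathcal{C}(\Omega)$ and $\mathcal{M}(\Omega)$). *)

theory Defs
  imports "HOL-Analysis.Analysis"
begin

subsection \<open>Finite signed Radon measures on a set\<close>

abbreviation borel_on :: "'a::topological_space set \<Rightarrow> 'a measure" where
  "borel_on \<Omega> \<equiv> restrict_space borel \<Omega>"

text \<open>
  A signed measure is a real-valued, countably additive function on the Borel subsets of
  \<open>\<Omega>\<close>. Off the Borel sets it is normalised to \<open>0\<close>, so that equality of signed measures is
  equality of functions. Finite Borel measures on a compact metric space are automatically
  regular, hence for compact \<open>\<Omega>\<close> these are exactly the finite signed Radon measures.
\<close>

type_synonym 'a smeasure = "'a set \<Rightarrow> real"

definition smeasures :: "'a::topological_space set \<Rightarrow> 'a smeasure set" where
  "smeasures \<Omega> = {\<nu>.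
     (\<forall>A. A \<notin> sets (borel_on \<Omega>) \<longrightarrow> \<nu> A = 0) \<and>
     (\<forall>A :: nat \<Rightarrow> 'a set. range A \<subseteq> sets (borel_on \<Omega>) \<longrightarrow> disjoint_family A \<longrightarrow>
        (\<lambda>i. \<nu> (A i)) sums \<nu> (\<Union>i. A i))}"

text \<open>
  Jordan decomposition: \<open>\<nu>\<^sup>+(A)\<close> is the supremum of \<open>\<nu>(B)\<close> over Borel sets \<open>B \<subseteq> A\<close>.
  As \<open>B = {}\<close> is admissible, truncation of negative values by \<open>ennreal\<close> is harmless.
\<close>

definition pos_part :: "'a::topological_space set \<Rightarrow> 'a smeasure \<Rightarrow> 'a measure" where
  "pos_part \<Omega> \<nu> = measure_of \<Omega> (sets (borel_on \<Omega>))
     (\<lambda>A. SUP B\<in>{B \<in> sets (borel_on \<Omega>). B \<subseteq> A}. ennreal (\<nu> B))"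

definition neg_part :: "'a::topological_space set \<Rightarrow> 'a smeasure \<Rightarrow> 'a measure" where
  "neg_part \<Omega> \<nu> = pos_part \<Omega> (\<lambda>A. - \<nu> A)"

definition total_var :: "'a::topological_space set \<Rightarrow> 'a smeasure \<Rightarrow> 'a measure" where
  "total_var \<Omega> \<nu> = measure_of \<Omega> (sets (borel_on \<Omega>))
     (\<lambda>A. emeasure (pos_part \<Omega> \<nu>) A + emeasure (neg_part \<Omega> \<nu>) A)"

text \<open>The pairing of \<open>C(\<Omega>)\<close> and \<open>M(\<Omega>)\<close>.\<close>

definition pairing :: "'a::topological_space set \<Rightarrow> ('a \<Rightarrow> real) \<Rightarrow> 'a smeasure \<Rightarrow> real" where
  "pairing \<Omega> f \<nu> =
     integral\<^sup>L (pos_part \<Omega> \<nu>) f - integral\<^sup>L (neg_part \<Omega> \<nu>) f"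

definition weak_star :: "'a::topological_space set \<Rightarrow> 'a smeasure topology" where
  "weak_star \<Omega> = topology_generated_by
     {{\<nu> \<in> smeasures \<Omega>. pairing \<Omega> f \<nu> \<in> U} | f U. continuous_on \<Omega> f \<and> open U}"

definition msupp :: "'a::topological_space measure \<Rightarrow> 'a set" where
  "msupp M = {x \<in> space M. \<forall>U. open U \<longrightarrow> x \<in> U \<longrightarrow> emeasure M (U \<inter> space M) > 0}"


subsection \<open>Optimal transport and the Kantorovich--Rubinstein norm\<close>

definition couplings ::
  "'a::topological_space set \<Rightarrow> 'a measure \<Rightarrow> 'a measure \<Rightarrow> ('a \<times> 'a) measure set" where
  "couplings \<Omega> \<mu> \<nu> = {\<gamma>. sets \<gamma> = sets (borel_on (\<Omega> \<times> \<Omega>)) \<and>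
     distr \<gamma> (borel_on \<Omega>) fst = \<mu> \<and> distr \<gamma> (borel_on \<Omega>) snd = \<nu>}"

definition transport_cost :: "real \<Rightarrow> ('a::real_normed_vector \<times> 'a) measure \<Rightarrow> ennreal" where
  "transport_cost p \<gamma> = (\<integral>\<^sup>+(x, y). ennreal (norm (x - y) powr p) \<partial>\<gamma>)"

text \<open>No \<open>1/p\<close>-th power is taken; the value is \<open>\<infinity>\<close> if there is no coupling.\<close>

definition Wp :: "'a::real_normed_vector set \<Rightarrow> real \<Rightarrow> 'a measure \<Rightarrow> 'a measure \<Rightarrow> ennreal" where
  "Wp \<Omega> p \<mu> \<nu> = (INF \<gamma>\<in>couplings \<Omega> \<mu> \<nu>. transport_cost p \<gamma>)"

definition Wp_beta :: "'a::real_normed_vector set \<Rightarrow> real \<Rightarrow> real \<Rightarrow> 'a smeasure \<Rightarrow> ennreal" where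
  "Wp_beta \<Omega> p \<beta> \<nu> = Wp \<Omega> p (pos_part \<Omega> \<nu>) (neg_part \<Omega> \<nu>)
     + ennreal (\<beta> / 2) * emeasure (total_var \<Omega> \<nu>) \<Omega>
     + (if \<nu> \<Omega> = 0 then 0 else \<infinity>)"

definition KR_norm ::
  "'a::real_normed_vector set \<Rightarrow> real \<Rightarrow> real \<Rightarrow> real \<Rightarrow> 'a smeasure \<Rightarrow> ennreal" where
  "KR_norm \<Omega> p \<alpha> \<beta> \<mu> = (INF \<nu>\<in>smeasures \<Omega>.
     Wp_beta \<Omega> p \<beta> \<nu> + ennreal \<alpha> * emeasure (total_var \<Omega> (\<lambda>A. \<mu> A - \<nu> A)) \<Omega>)"


subsection \<open>Convex analysis\<close>

definition strictly_convex :: "('b::real_vector \<Rightarrow> real) \<Rightarrow> bool" where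
  "strictly_convex F \<longleftrightarrow> (\<forall>u v t. u \<noteq> v \<longrightarrow> 0 < t \<longrightarrow> t < 1 \<longrightarrow>
     F ((1 - t) *\<^sub>R u + t *\<^sub>R v) < (1 - t) * F u + t * F v)"

text \<open>
  Subgradients at \<open>\<mu>\<close> of an extended real function on \<open>M(\<Omega>)\<close>; a subgradient is an element of
  \<open>C(\<Omega>)\<close>, so its values outside \<open>\<Omega>\<close> are irrelevant.
\<close>

definition subdifferential ::
  "'a::topological_space set \<Rightarrow> ('a smeasure \<Rightarrow> ereal) \<Rightarrow> 'a smeasure \<Rightarrow> ('a \<Rightarrow> real) set" where
  "subdifferential \<Omega> \<phi> \<mu> = {q. continuous_on \<Omega> q \<and>
     (\<forall>\<eta>\<in>smeasures \<Omega>. \<phi> \<mu> + ereal (pairing \<Omega> q (\<lambda>A. \<eta> A - \<mu> A)) \<le> \<phi> \<eta>)}"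


subsection \<open>The measurement operator and the optimisation problem\<close>

definition linear_on_smeasures ::
  "'a::topological_space set \<Rightarrow> ('a smeasure \<Rightarrow> 'b::real_vector) \<Rightarrow> bool" where
  "linear_on_smeasures \<Omega> K \<longleftrightarrow>
     (\<forall>\<mu>\<in>smeasures \<Omega>. \<forall>\<nu>\<in>smeasures \<Omega>. K (\<lambda>A. \<mu> A + \<nu> A) = K \<mu> + K \<nu>) \<and>
     (\<forall>c. \<forall>\<mu>\<in>smeasures \<Omega>. K (\<lambda>A. c * \<mu> A) = c *\<^sub>R K \<mu>)"

definition is_preadjoint ::
  "'a::topological_space set \<Rightarrow> ('a smeasure \<Rightarrow> 'b::real_inner) \<Rightarrow> ('b \<Rightarrow> 'a \<Rightarrow> real) \<Rightarrow> bool" where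
  "is_preadjoint \<Omega> K Kpre \<longleftrightarrow> (\<forall>v. continuous_on \<Omega> (Kpre v) \<and>
     (\<forall>\<mu>\<in>smeasures \<Omega>. pairing \<Omega> (Kpre v) \<mu> = v \<bullet> K \<mu>))"

definition objective ::
  "'a::real_normed_vector set \<Rightarrow> real \<Rightarrow> real \<Rightarrow> real \<Rightarrow> ('b \<Rightarrow> real) \<Rightarrow> ('a smeasure \<Rightarrow> 'b)
    \<Rightarrow> 'a smeasure \<Rightarrow> ereal" where
  "objective \<Omega> p \<alpha> \<beta> F K \<mu> = ereal (F (K \<mu>)) + enn2ereal (KR_norm \<Omega> p \<alpha> \<beta> \<mu>)"

definition Psi :: "real \<Rightarrow> real \<Rightarrow> ('a::real_normed_vector \<Rightarrow> real) \<Rightarrow> 'a \<Rightarrow> 'a \<Rightarrow> real" where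
  "Psi p \<beta> q x y = (q x - q y) / (norm (x - y) powr p + \<beta>)"

end

theory Submission imports Defs "HOL-Probability.Giry_Monad" begin

text \<open>
  The norm is a linear program: for a pair of a measure \<open>\<nu>\<close> of total mass \<open>0\<close> and a coupling \<open>\<gamma>\<close>
  of its Jordan parts, \<open>\<gamma>\<close> pays \<open>\<bar>x - y\<bar>\<^sup>p + \<beta>\<close> per unit of mass and \<open>\<mu> - \<nu>\<close> pays \<open>\<alpha>\<close>
  (\<open>plan_cost\<close>). The dual constraints on a potential \<open>q\<close> are \<open>\<bar>q\<bar> \<le> \<alpha>\<close> and
  \<open>q x - q y \<le> \<bar>x - y\<bar>\<^sup>p + \<beta>\<close>, the latter being \<open>\<Psi>\<^sub>q \<le> 1\<close>. The cost of any plan minus the pairing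
  of \<open>q\<close> with \<open>\<mu>\<close> is an integral of the slacks of these constraints (\<open>plan_cost_eq\<close>); so a feasible
  \<open>q\<close> bounds the norm from below, and the bound is attained by a plan exactly if its three
  measures are supported where the constraints are active (\<open>plan_cost_duality\<close>).

  The equivalence of the three statements is proved as a cycle. A subgradient at \<open>\<mu>\<close> of the form
  \<open>- K\<^sub>* \<nabla>F(K \<mu>)\<close> makes \<open>\<mu>\<close> a minimiser because \<open>F\<close> is convex (\<open>subgradient_imp_arg_min\<close>). A
  minimiser yields the constraints and the tightness of the duality bound
  (\<open>arg_min_imp_dual_certificate\<close>). Finally these imply the subgradient inequality, since the
  pairing with \<open>q\<close> is below the norm everywhere and equals it at \<open>\<mu>\<close>.

  In the middle step the given optimal plan is perturbed in a few directions: point masses, dipoles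
  \<open>\<delta>\<^sub>x - \<delta>\<^sub>y\<close> and \<open>- \<mu>\<close>. Each perturbed plan bounds the norm of the perturbed measure
  from above, and comparison with the derivative of \<open>F \<circ> K\<close> gives one inequality. The difficulty
  is that a dipole may cancel part of \<open>\<nu>\<close>. This happens only at atoms of \<open>\<nu>\<close>; there are countably
  many of these, and in a convex set with more than one point their complement is dense, so
  continuity of \<open>q\<close> supplies the missing inequalities.
\<close>

section \<open>The sum of two measures\<close>

definition sum_measure :: "'a measure \<Rightarrow> 'a measure \<Rightarrow> 'a measure" where
  "sum_measure M N = measure_of (space M) (sets M) (\<lambda>A. emeasure M A + emeasure N A)"

lemma sets_sum_measure [simp, measurable_cong]: "sets (sum_measure M N) = sets M"
  by (simp add: sum_measure_def)

lemma space_sum_measure [simp]: "space (sum_measure M N) = space M"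
  by (simp add: sum_measure_def)

lemma emeasure_sum_measure:
  assumes N: "sets N = sets M" and A: "A \<in> sets M"
  shows "emeasure (sum_measure M N) A = emeasure M A + emeasure N A"
  unfolding sum_measure_def
proof (rule emeasure_measure_of_sigma)
  show "countably_additive (sets M) (\<lambda>A. emeasure M A + emeasure N A)"
  proof (rule countably_additiveI)
    fix A :: "nat \<Rightarrow> 'a set"
    assume A: "range A \<subseteq> sets M" "disjoint_family A"
    have "(\<Sum>i. emeasure M (A i)) = emeasure M (\<Union>i. A i)"
      "(\<Sum>i. emeasure N (A i)) = emeasure N (\<Union>i. A i)"
      using A N suminf_emeasure[of A M] suminf_emeasure[of A N] by simp_all
    then show "(\<Sum>i. emeasure M (A i) + emeasure N (A i)) =
      emeasure M (\<Union>i. A i) + emeasure N (\<Union>i. A i)"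
      using suminf_add[of "\<lambda>i. emeasure M (A i)" "\<lambda>i. emeasure N (A i)"] by simp
  qed
qed (auto simp: positive_def A sets.sigma_algebra_axioms)

lemma nn_integral_sum_measure:
  assumes N: "sets N = sets M" and f: "f \<in> borel_measurable M"
  shows "integral\<^sup>N (sum_measure M N) f = integral\<^sup>N M f + integral\<^sup>N N f"
proof -
  have meas: "borel_measurable N = (borel_measurable M :: ('a \<Rightarrow> ennreal) set)"
    "borel_measurable (sum_measure M N) = (borel_measurable M :: ('a \<Rightarrow> ennreal) set)"
    using N by (simp_all cong: measurable_cong_sets)
  note space = sets_eq_imp_space_eq[OF N]
  show ?thesis
    using f
  proof induction
    case (cong f g)
    have "integral\<^sup>N L f = integral\<^sup>N L g" if "space L = space M" for L
      using cong(3) that by (intro nn_integral_cong) simp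
    then show ?case using cong(4) space by simp
  next
    case (set A)
    then show ?case using N by (simp add: emeasure_sum_measure)
  next
    case (mult u c)
    then show ?case by (simp add: nn_integral_cmult meas distrib_left)
  next
    case (add u v)
    then show ?case by (simp add: nn_integral_add meas ac_simps)
  next
    case (seq U)
    have "incseq (\<lambda>i. integral\<^sup>N L (U i))" for L
      using \<open>incseq U\<close> by (auto simp: incseq_def le_fun_def intro!: nn_integral_mono)
    then show ?case
      using seq unfolding SUP_apply[abs_def]
      by (simp add: nn_integral_monotone_convergence_SUP meas ennreal_SUP_add)
  qed
qed

section \<open>Signed measures and their Jordan parts\<close>

lemma space_borel_on [simp]: "space (borel_on \<Omega>) = \<Omega>"
  by (simp add: space_restrict_space)

lemma smeasures_sums:
  assumes "\<nu> \<in> smeasures \<Omega>" "range A \<subseteq> sets (borel_on \<Omega>)" "disjoint_family A"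
  shows "(\<lambda>i. \<nu> (A i)) sums \<nu> (\<Union>i. A i)"
  using assms unfolding smeasures_def by blast

lemma smeasures_empty [simp]:
  assumes "\<nu> \<in> smeasures \<Omega>"
  shows "\<nu> {} = 0"
proof -
  have "(\<lambda>i::nat. \<nu> {}) sums \<nu> (\<Union>i::nat. {})"
    by (rule smeasures_sums[OF assms]) (auto simp: disjoint_family_on_def)
  then have "summable (\<lambda>i::nat. \<nu> {})" by (rule sums_summable)
  then show ?thesis by (simp add: summable_const_iff)
qed

lemma smeasures_Un:
  assumes "\<nu> \<in> smeasures \<Omega>" "A \<in> sets (borel_on \<Omega>)" "B \<in> sets (borel_on \<Omega>)" "A \<inter> B = {}"
  shows "\<nu> (A \<union> B) = \<nu> A + \<nu> B"
proof -
  let ?C = "binaryset A B"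
  have "(\<lambda>i. \<nu> (?C i)) sums \<nu> (\<Union>i. ?C i)"
    using assms by (intro smeasures_sums)
      (auto simp: binaryset_def disjoint_family_on_def split: if_splits)
  moreover have "(\<lambda>i. \<nu> (?C i)) sums (\<nu> A + \<nu> B)"
    using assms by (intro binaryset_sums) simp
  ultimately show ?thesis by (simp add: UN_binaryset_eq sums_unique2)
qed

lemma smeasures_Diff:
  assumes "\<nu> \<in> smeasures \<Omega>" "A \<in> sets (borel_on \<Omega>)" "B \<in> sets (borel_on \<Omega>)" "B \<subseteq> A"
  shows "\<nu> (A - B) = \<nu> A - \<nu> B"
proof -
  have "\<nu> ((A - B) \<union> B) = \<nu> (A - B) + \<nu> B"
    using assms by (intro smeasures_Un) auto
  moreover have "(A - B) \<union> B = A" using assms(4) by blast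
  ultimately show ?thesis by simp
qed

lemma smeasures_add:
  assumes "\<mu> \<in> smeasures \<Omega>" "\<nu> \<in> smeasures \<Omega>"
  shows "(\<lambda>A. \<mu> A + \<nu> A) \<in> smeasures \<Omega>"
  using assms unfolding smeasures_def by (auto intro: sums_add)

lemma smeasures_cmult:
  assumes "\<mu> \<in> smeasures \<Omega>"
  shows "(\<lambda>A. c * \<mu> A) \<in> smeasures \<Omega>"
  using assms unfolding smeasures_def by (auto intro: sums_mult)

lemma smeasures_uminus:
  assumes "\<mu> \<in> smeasures \<Omega>"
  shows "(\<lambda>A. - \<mu> A) \<in> smeasures \<Omega>"
  using smeasures_cmult[OF assms, of "-1"] by simp

lemma smeasures_diff:
  assumes "\<mu> \<in> smeasures \<Omega>" "\<nu> \<in> smeasures \<Omega>"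
  shows "(\<lambda>A. \<mu> A - \<nu> A) \<in> smeasures \<Omega>"
  using smeasures_add[OF assms(1) smeasures_uminus[OF assms(2)]] by simp

lemma ennreal_add_le: "ennreal (a + b) \<le> ennreal a + ennreal b"
  by (cases "0 \<le> a"; cases "0 \<le> b")
    (auto simp: ennreal_neg simp flip: ennreal_plus intro: ennreal_leI)

lemma ennreal_sum_le: "ennreal (sum f I) \<le> (\<Sum>i\<in>I. ennreal (f i))"
proof (induction I rule: infinite_finite_induct)
  case (insert x I)
  then show ?case
    using ennreal_add_le[of "f x" "sum f I"] by (simp add: order_trans add_left_mono)
qed auto

abbreviation upper_variation :: "'a::topological_space set \<Rightarrow> 'a smeasure \<Rightarrow> 'a set \<Rightarrow> ennreal" where
  "upper_variation \<Omega> \<nu> A \<equiv> (SUP B\<in>{B \<in> sets (borel_on \<Omega>). B \<subseteq> A}. ennreal (\<nu> B))"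

lemma upper_variation_mono: "A \<subseteq> A' \<Longrightarrow> upper_variation \<Omega> \<nu> A \<le> upper_variation \<Omega> \<nu> A'"
  by (rule SUP_subset_mono) auto

text \<open>Disjoint subsets of \<open>A\<close> and \<open>A'\<close> unite to a competitor for \<open>A \<union> A'\<close>. This half of additivity
  needs two sets at a time only; the subadditive half is proved for countably many at once, by
  cutting one competitor for the union into pieces.\<close>

lemma upper_variation_superadditive:
  assumes "\<nu> \<in> smeasures \<Omega>" "A \<inter> A' = {}"
  shows "upper_variation \<Omega> \<nu> A + upper_variation \<Omega> \<nu> A' \<le> upper_variation \<Omega> \<nu> (A \<union> A')"
proof -
  have "ennreal (\<nu> B) + ennreal (\<nu> B') \<le> upper_variation \<Omega> \<nu> (A \<union> A')"
    if B: "B \<in> sets (borel_on \<Omega>)" "B \<subseteq> A" and B': "B' \<in> sets (borel_on \<Omega>)" "B' \<subseteq> A'" for B B'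
  proof -
    \<comment> \<open>Sets of negative measure are dropped, so that \<open>ennreal\<close> truncates nothing.\<close>
    define C where "C = (if 0 \<le> \<nu> B then B else {})"
    define C' where "C' = (if 0 \<le> \<nu> B' then B' else {})"
    have C: "C \<in> sets (borel_on \<Omega>)" "C' \<in> sets (borel_on \<Omega>)" "C \<subseteq> A" "C' \<subseteq> A'"
      using B B' by (auto simp: C_def C'_def)
    have "0 \<le> \<nu> C" "0 \<le> \<nu> C'" "ennreal (\<nu> B) = ennreal (\<nu> C)" "ennreal (\<nu> B') = ennreal (\<nu> C')"
      using assms(1) by (auto simp: C_def C'_def ennreal_neg)
    moreover have "\<nu> (C \<union> C') = \<nu> C + \<nu> C'"
      using C assms(2) by (intro smeasures_Un[OF assms(1)]) auto
    ultimately have "ennreal (\<nu> B) + ennreal (\<nu> B') = ennreal (\<nu> (C \<union> C'))"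
      by simp
    also have "\<dots> \<le> upper_variation \<Omega> \<nu> (A \<union> A')"
      using C by (intro SUP_upper) auto
    finally show ?thesis .
  qed
  then have "ennreal (\<nu> B) + upper_variation \<Omega> \<nu> A' \<le> upper_variation \<Omega> \<nu> (A \<union> A')"
    if "B \<in> sets (borel_on \<Omega>)" "B \<subseteq> A" for B
    using that by (subst ennreal_SUP_add_right) (auto intro!: SUP_least)
  then show ?thesis
    by (subst ennreal_SUP_add_left[symmetric]) (auto intro!: SUP_least)
qed

lemma upper_variation_empty:
  assumes "\<nu> \<in> smeasures \<Omega>"
  shows "upper_variation \<Omega> \<nu> {} = 0"
  using assms by (auto simp: SUP_eq_iff intro!: antisym SUP_least)

lemma upper_variation_countably_additive:
  assumes "\<nu> \<in> smeasures \<Omega>"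
  shows "countably_additive (sets (borel_on \<Omega>)) (upper_variation \<Omega> \<nu>)"
proof (rule countably_additiveI)
  fix A :: "nat \<Rightarrow> 'a set"
  assume A: "range A \<subseteq> sets (borel_on \<Omega>)" and disj: "disjoint_family A"
  let ?P = "upper_variation \<Omega> \<nu>"
  show "(\<Sum>i. ?P (A i)) = ?P (\<Union>i. A i)"
  proof (rule antisym)
    have "(\<Sum>i<n. ?P (A i)) \<le> ?P (\<Union>i<n. A i)" for n
    proof (induction n)
      case 0
      then show ?case using upper_variation_empty[OF assms] by simp
    next
      case (Suc n)
      have "(\<Union>i<n. A i) \<inter> A n = {}"
        using disj by (auto simp: disjoint_family_on_def dest: less_imp_neq)
      then have "?P (\<Union>i<n. A i) + ?P (A n) \<le> ?P ((\<Union>i<n. A i) \<union> A n)"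
        by (rule upper_variation_superadditive[OF assms])
      moreover have "(\<Union>i<n. A i) \<union> A n = (\<Union>i<Suc n. A i)"
        by (auto simp: less_Suc_eq)
      ultimately have "?P (\<Union>i<n. A i) + ?P (A n) \<le> ?P (\<Union>i<Suc n. A i)" by simp
      moreover have "(\<Sum>i<Suc n. ?P (A i)) \<le> ?P (\<Union>i<n. A i) + ?P (A n)"
        using Suc by (simp add: add_right_mono)
      ultimately show ?case by (rule order_trans[rotated])
    qed
    also have "?P (\<Union>i<n. A i) \<le> ?P (\<Union>i. A i)" for n
      by (rule upper_variation_mono) auto
    finally have *: "(\<Sum>i<n. ?P (A i)) \<le> ?P (\<Union>i. A i)" for n .
    show "(\<Sum>i. ?P (A i)) \<le> ?P (\<Union>i. A i)"
      unfolding suminf_eq_SUP by (intro SUP_least *)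
  next
    show "?P (\<Union>i. A i) \<le> (\<Sum>i. ?P (A i))"
    proof (rule SUP_least, safe)
      fix B assume B: "B \<in> sets (borel_on \<Omega>)" "B \<subseteq> (\<Union>i. A i)"
      have "(\<lambda>i. \<nu> (B \<inter> A i)) sums \<nu> (\<Union>i. B \<inter> A i)"
        using A B by (intro smeasures_sums[OF assms] disjoint_family_subset[OF disj]) auto
      also have "(\<Union>i. B \<inter> A i) = B" using B by auto
      finally have "(\<lambda>n. ennreal (\<Sum>i<n. \<nu> (B \<inter> A i))) \<longlonglongrightarrow> ennreal (\<nu> B)"
        unfolding sums_def by (rule tendsto_ennrealI)
      moreover have "ennreal (\<Sum>i<n. \<nu> (B \<inter> A i)) \<le> (\<Sum>i. ?P (A i))" for n
      proof -
        have "ennreal (\<Sum>i<n. \<nu> (B \<inter> A i)) \<le> (\<Sum>i<n. ennreal (\<nu> (B \<inter> A i)))"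
          by (rule ennreal_sum_le)
        also have "\<dots> \<le> (\<Sum>i<n. ?P (A i))"
          using A B by (intro sum_mono SUP_upper) auto
        also have "\<dots> \<le> (\<Sum>i. ?P (A i))"
          by (intro sum_le_suminf) auto
        finally show ?thesis .
      qed
      ultimately show "ennreal (\<nu> B) \<le> (\<Sum>i. ?P (A i))"
        by (intro LIMSEQ_le_const2) auto
    qed
  qed
qed

lemma sets_pos_part [simp, measurable_cong]: "sets (pos_part \<Omega> \<nu>) = sets (borel_on \<Omega>)"
  unfolding pos_part_def using sets.sigma_sets_eq[of "borel_on \<Omega>"] sets.space_closed[of "borel_on \<Omega>"]
  by (simp add: sets_measure_of)

lemma space_pos_part [simp]: "space (pos_part \<Omega> \<nu>) = \<Omega>"
  using sets_eq_imp_space_eq[OF sets_pos_part] by simp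

lemma sets_neg_part [simp, measurable_cong]: "sets (neg_part \<Omega> \<nu>) = sets (borel_on \<Omega>)"
  by (simp add: neg_part_def)

lemma space_neg_part [simp]: "space (neg_part \<Omega> \<nu>) = \<Omega>"
  by (simp add: neg_part_def)

lemma emeasure_pos_part:
  assumes "\<nu> \<in> smeasures \<Omega>" "A \<in> sets (borel_on \<Omega>)"
  shows "emeasure (pos_part \<Omega> \<nu>) A = upper_variation \<Omega> \<nu> A"
  unfolding pos_part_def
proof (rule emeasure_measure_of_sigma)
  show "sigma_algebra \<Omega> (sets (borel_on \<Omega>))"
    using sets.sigma_algebra_axioms[of "borel_on \<Omega>"] by simp
  show "positive (sets (borel_on \<Omega>)) (upper_variation \<Omega> \<nu>)"
    using upper_variation_empty[OF assms(1)] by (simp add: positive_def)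
qed (use assms upper_variation_countably_additive in auto)

lemma emeasure_neg_part:
  assumes "\<nu> \<in> smeasures \<Omega>" "A \<in> sets (borel_on \<Omega>)"
  shows "emeasure (neg_part \<Omega> \<nu>) A = upper_variation \<Omega> (\<lambda>A. - \<nu> A) A"
  unfolding neg_part_def by (rule emeasure_pos_part[OF smeasures_uminus[OF assms(1)] assms(2)])

lemma total_var_eq_sum_measure: "total_var \<Omega> \<nu> = sum_measure (pos_part \<Omega> \<nu>) (neg_part \<Omega> \<nu>)"
  by (simp add: total_var_def sum_measure_def)

text \<open>Suppose that the variation is infinite. A set of infinite variation contains a subset whose
  measure is so large that both it and its relative complement have measure at least \<open>1\<close> in
  modulus, and one of the two again has infinite variation. Splitting off the other one again and again produces a disjoint sequence whose
  measures do not tend to \<open>0\<close>.\<close>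

lemma smeasure_variation_finite:
  assumes \<nu>: "\<nu> \<in> smeasures \<Omega>"
  shows "upper_variation \<Omega> \<nu> \<Omega> + upper_variation \<Omega> (\<lambda>A. - \<nu> A) \<Omega> \<noteq> \<infinity>"
proof
  let ?S = "sets (borel_on \<Omega>)"
  define V where "V A = emeasure (pos_part \<Omega> \<nu>) A + emeasure (neg_part \<Omega> \<nu>) A" for A
  have V: "V A = upper_variation \<Omega> \<nu> A + upper_variation \<Omega> (\<lambda>A. - \<nu> A) A" if "A \<in> ?S" for A
    using that \<nu> by (simp add: V_def emeasure_pos_part emeasure_neg_part)
  assume "upper_variation \<Omega> \<nu> \<Omega> + upper_variation \<Omega> (\<lambda>A. - \<nu> A) \<Omega> = \<infinity>"
  then have top: "V \<Omega> = \<infinity>"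
    using V[of \<Omega>] sets.top[of "borel_on \<Omega>"] by simp
  have split: "\<exists>B. B \<in> ?S \<and> B \<subseteq> E \<and> V B = \<infinity> \<and> 1 \<le> \<bar>\<nu> (E - B)\<bar>"
    if E: "E \<in> ?S" "V E = \<infinity>" for E
  proof -
    have "\<exists>B. B \<in> ?S \<and> B \<subseteq> E \<and> 1 + \<bar>\<nu> E\<bar> \<le> \<bar>\<nu> B\<bar>"
    proof (rule ccontr)
      assume "\<not> ?thesis"
      then have bound: "\<bar>\<nu> B\<bar> \<le> 1 + \<bar>\<nu> E\<bar>" if "B \<in> ?S" "B \<subseteq> E" for B
        using that by (meson linear)
      have "\<nu> B \<le> 1 + \<bar>\<nu> E\<bar>" "- \<nu> B \<le> 1 + \<bar>\<nu> E\<bar>" if "B \<in> ?S" "B \<subseteq> E" for B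
        using bound[OF that] by linarith+
      then have "upper_variation \<Omega> \<nu> E \<le> ennreal (1 + \<bar>\<nu> E\<bar>)"
        "upper_variation \<Omega> (\<lambda>A. - \<nu> A) E \<le> ennreal (1 + \<bar>\<nu> E\<bar>)"
        by (auto simp del: ennreal_plus intro!: SUP_least ennreal_leI)
      then have "V E \<le> ennreal (1 + \<bar>\<nu> E\<bar>) + ennreal (1 + \<bar>\<nu> E\<bar>)"
        unfolding V[OF E(1)] by (rule add_mono)
      also have "\<dots> < \<infinity>" by simp
      finally show False using E by simp
    qed
    then obtain B where B: "B \<in> ?S" "B \<subseteq> E" "1 + \<bar>\<nu> E\<bar> \<le> \<bar>\<nu> B\<bar>" by blast
    have EB: "E - B \<in> ?S" using E B by auto
    have "\<nu> (E - B) = \<nu> E - \<nu> B" using smeasures_Diff[OF \<nu>] E B by auto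
    then have big: "1 \<le> \<bar>\<nu> (E - B)\<bar>" "1 \<le> \<bar>\<nu> B\<bar>" using B by linarith+
    have "V E = V B + V (E - B)"
      unfolding V_def
      using plus_emeasure[of B "pos_part \<Omega> \<nu>" "E - B"] plus_emeasure[of B "neg_part \<Omega> \<nu>" "E - B"]
        B EB by (simp add: Un_absorb1 ac_simps)
    then have "V B = \<infinity> \<or> V (E - B) = \<infinity>"
      using E(2) by (metis ennreal_add_eq_top infinity_ennreal_def)
    then consider "V B = \<infinity>" | "V (E - B) = \<infinity>" by blast
    then show ?thesis
    proof cases
      case 1
      then show ?thesis using B big by auto
    next
      case 2
      moreover have "E - (E - B) = B" using B by auto
      ultimately show ?thesis using EB big by (intro exI[of _ "E - B"]) auto
    qed
  qed
  define step where "step E = (SOME B. B \<in> ?S \<and> B \<subseteq> E \<and> V B = \<infinity> \<and> 1 \<le> \<bar>\<nu> (E - B)\<bar>)" for E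
  have step: "step E \<in> ?S" "step E \<subseteq> E" "V (step E) = \<infinity>" "1 \<le> \<bar>\<nu> (E - step E)\<bar>"
    if "E \<in> ?S" "V E = \<infinity>" for E
    using someI_ex[OF split[OF that]] unfolding step_def by blast+
  define E where "E n = (step ^^ n) \<Omega>" for n
  have E_Suc: "E (Suc n) = step (E n)" for n by (simp add: E_def)
  have E: "E n \<in> ?S \<and> V (E n) = \<infinity>" for n
    by (induction n) (use top step sets.top[of "borel_on \<Omega>"] in \<open>auto simp: E_Suc, auto simp: E_def\<close>)
  have "decseq E"
    using E step(2) by (intro decseq_SucI) (auto simp: E_Suc)
  define A where "A n = E n - E (Suc n)" for n
  have "disjoint_family A"
  proof -
    have "A m \<inter> A n = {}" if "m < n" for m n
      using decseqD[OF \<open>decseq E\<close>, of "Suc m" n] that by (auto simp: A_def)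
    then show ?thesis
      unfolding disjoint_family_on_def by (metis Int_commute linorder_neqE_nat)
  qed
  moreover have "range A \<subseteq> ?S" using E by (auto simp: A_def)
  ultimately have "(\<lambda>i. \<nu> (A i)) sums \<nu> (\<Union>i. A i)" by (intro smeasures_sums[OF \<nu>])
  then have "(\<lambda>i. \<nu> (A i)) \<longlonglongrightarrow> 0" by (intro summable_LIMSEQ_zero sums_summable)
  then have "eventually (\<lambda>i. norm (\<nu> (A i)) < 1) sequentially"
    using order_tendstoD(2)[OF tendsto_norm_zero, of "\<lambda>i. \<nu> (A i)" sequentially 1] by simp
  then obtain i where "\<bar>\<nu> (A i)\<bar> < 1" by (auto simp: eventually_sequentially)
  then show False using step(4)[of "E i"] E by (simp add: A_def E_Suc not_less flip: not_le)
qed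

lemma finite_measure_pos_part:
  assumes "\<nu> \<in> smeasures \<Omega>"
  shows "finite_measure (pos_part \<Omega> \<nu>)"
proof
  show "emeasure (pos_part \<Omega> \<nu>) (space (pos_part \<Omega> \<nu>)) \<noteq> \<infinity>"
    using smeasure_variation_finite[OF assms] sets.top[of "borel_on \<Omega>"]
    by (simp add: emeasure_pos_part[OF assms])
qed

lemma finite_measure_neg_part:
  assumes "\<nu> \<in> smeasures \<Omega>"
  shows "finite_measure (neg_part \<Omega> \<nu>)"
  unfolding neg_part_def by (rule finite_measure_pos_part[OF smeasures_uminus[OF assms]])

text \<open>Replacing \<open>B \<subseteq> A\<close> by \<open>A - B\<close> in the supremum that defines the
  negative part turns it into the one that defines the positive part, up to the constant \<open>\<nu> A\<close>.\<close>

lemma jordan_decomposition: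
  assumes \<nu>: "\<nu> \<in> smeasures \<Omega>" and A: "A \<in> sets (borel_on \<Omega>)"
  shows "\<nu> A = measure (pos_part \<Omega> \<nu>) A - measure (neg_part \<Omega> \<nu>) A"
proof -
  have *: "\<nu> A + measure (neg_part \<Omega> \<nu>) A \<ge> measure (pos_part \<Omega> \<nu>) A" if \<nu>: "\<nu> \<in> smeasures \<Omega>" for \<nu>
  proof -
    interpret N: finite_measure "neg_part \<Omega> \<nu>" by (rule finite_measure_neg_part[OF \<nu>])
    interpret P: finite_measure "pos_part \<Omega> \<nu>" by (rule finite_measure_pos_part[OF \<nu>])
    have le: "\<nu> B \<le> \<nu> A + measure (neg_part \<Omega> \<nu>) A" if "B \<in> sets (borel_on \<Omega>)" "B \<subseteq> A" for B
    proof -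
      have "ennreal (- \<nu> (A - B)) \<le> emeasure (neg_part \<Omega> \<nu>) A"
        using A that unfolding emeasure_neg_part[OF \<nu> A] by (intro SUP_upper) auto
      then have "- \<nu> (A - B) \<le> measure (neg_part \<Omega> \<nu>) A"
        by (simp add: N.emeasure_eq_measure ennreal_le_iff)
      then show ?thesis using smeasures_Diff[OF \<nu> A that] by simp
    qed
    from le[of "{}"] have nn: "0 \<le> \<nu> A + measure (neg_part \<Omega> \<nu>) A" using \<nu> by simp
    have "emeasure (pos_part \<Omega> \<nu>) A \<le> ennreal (\<nu> A + measure (neg_part \<Omega> \<nu>) A)"
      unfolding emeasure_pos_part[OF \<nu> A] using le by (auto intro!: SUP_least ennreal_leI)
    then show ?thesis by (simp add: P.emeasure_eq_measure nn)
  qed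
  from *[OF \<nu>] *[OF smeasures_uminus[OF \<nu>]] show ?thesis
    by (simp add: neg_part_def)
qed

lemma emeasure_total_var:
  assumes "A \<in> sets (borel_on \<Omega>)"
  shows "emeasure (total_var \<Omega> \<nu>) A = emeasure (pos_part \<Omega> \<nu>) A + emeasure (neg_part \<Omega> \<nu>) A"
  using assms by (simp add: total_var_eq_sum_measure emeasure_sum_measure)

lemma total_var_add_le:
  assumes "\<mu> \<in> smeasures \<Omega>" "\<nu> \<in> smeasures \<Omega>" "A \<in> sets (borel_on \<Omega>)"
  shows "emeasure (total_var \<Omega> (\<lambda>A. \<mu> A + \<nu> A)) A
    \<le> emeasure (total_var \<Omega> \<mu>) A + emeasure (total_var \<Omega> \<nu>) A"
proof -
  have *: "upper_variation \<Omega> (\<lambda>A. \<mu> A + \<nu> A) A \<le> upper_variation \<Omega> \<mu> A + upper_variation \<Omega> \<nu> A"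
    for \<mu> \<nu> :: "'a smeasure"
  proof (rule SUP_least, safe)
    fix B assume B: "B \<in> sets (borel_on \<Omega>)" "B \<subseteq> A"
    have "ennreal (\<mu> B + \<nu> B) \<le> ennreal (\<mu> B) + ennreal (\<nu> B)" by (rule ennreal_add_le)
    also have "\<dots> \<le> upper_variation \<Omega> \<mu> A + upper_variation \<Omega> \<nu> A"
      using B by (intro add_mono SUP_upper) auto
    finally show "ennreal (\<mu> B + \<nu> B) \<le> upper_variation \<Omega> \<mu> A + upper_variation \<Omega> \<nu> A" .
  qed
  from add_mono[OF *[of \<mu> \<nu>] *[of "\<lambda>A. - \<mu> A" "\<lambda>A. - \<nu> A"]] assms show ?thesis
    by (simp add: emeasure_total_var emeasure_pos_part emeasure_neg_part smeasures_add smeasures_uminus ac_simps)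
qed

lemma pos_part_cmult:
  assumes \<nu>: "\<nu> \<in> smeasures \<Omega>" and c: "0 \<le> c"
  shows "pos_part \<Omega> (\<lambda>A. c * \<nu> A) = scale_measure (ennreal c) (pos_part \<Omega> \<nu>)"
  by (rule measure_eqI)
    (auto simp: emeasure_pos_part \<nu> smeasures_cmult ennreal_mult' c SUP_mult_left_ennreal)

lemma neg_part_cmult:
  assumes \<nu>: "\<nu> \<in> smeasures \<Omega>" and c: "0 \<le> c"
  shows "neg_part \<Omega> (\<lambda>A. c * \<nu> A) = scale_measure (ennreal c) (neg_part \<Omega> \<nu>)"
  using pos_part_cmult[OF smeasures_uminus[OF \<nu>] c] by (simp add: neg_part_def)

lemma total_var_cmult:
  assumes \<nu>: "\<nu> \<in> smeasures \<Omega>" and c: "0 \<le> c" and A: "A \<in> sets (borel_on \<Omega>)"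
  shows "emeasure (total_var \<Omega> (\<lambda>A. c * \<nu> A)) A = ennreal c * emeasure (total_var \<Omega> \<nu>) A"
  using assms
  by (simp add: emeasure_total_var smeasures_cmult pos_part_cmult neg_part_cmult distrib_left)

lemma total_var_uminus:
  assumes "A \<in> sets (borel_on \<Omega>)"
  shows "emeasure (total_var \<Omega> (\<lambda>A. - \<nu> A)) A = emeasure (total_var \<Omega> \<nu>) A"
  using assms by (simp add: emeasure_total_var neg_part_def add.commute)

lemma measure_in_smeasures:
  assumes "finite_measure M" "sets M = sets (borel_on \<Omega>)"
  shows "measure M \<in> smeasures \<Omega>"
proof -
  interpret finite_measure M by fact
  show ?thesis
    using assms(2) unfolding smeasures_def
    by (auto simp: measure_notin_sets intro!: finite_measure_UNION)
qed

text \<open>A measure is monotone, so the supremum over \<open>B \<subseteq> A\<close> is attained at \<open>A\<close>.\<close>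

lemma pos_part_measure:
  assumes "finite_measure M" "sets M = sets (borel_on \<Omega>)"
  shows "pos_part \<Omega> (measure M) = M"
proof (rule measure_eqI)
  interpret finite_measure M by fact
  fix A assume "A \<in> sets (pos_part \<Omega> (measure M))"
  then have A: "A \<in> sets (borel_on \<Omega>)" by simp
  have "upper_variation \<Omega> (measure M) A = emeasure M A"
    using A assms(2)
    by (intro antisym SUP_least SUP_upper2[of A])
      (auto simp: emeasure_eq_measure intro!: ennreal_leI finite_measure_mono)
  then show "emeasure (pos_part \<Omega> (measure M)) A = emeasure M A"
    using emeasure_pos_part[OF measure_in_smeasures[OF assms] A] by simp
qed (simp add: assms(2))

lemma neg_part_measure:
  assumes "finite_measure M" "sets M = sets (borel_on \<Omega>)"
  shows "neg_part \<Omega> (measure M) = null_measure (borel_on \<Omega>)"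
proof (rule measure_eqI)
  fix A assume "A \<in> sets (neg_part \<Omega> (measure M))"
  then have A: "A \<in> sets (borel_on \<Omega>)" by simp
  have "upper_variation \<Omega> (\<lambda>A. - measure M A) A = 0"
    by (intro antisym SUP_least) (auto simp: ennreal_neg)
  then show "emeasure (neg_part \<Omega> (measure M)) A = emeasure (null_measure (borel_on \<Omega>)) A"
    using emeasure_neg_part[OF measure_in_smeasures[OF assms] A] by simp
qed simp

lemma pairing_measure:
  assumes "finite_measure M" "sets M = sets (borel_on \<Omega>)"
  shows "pairing \<Omega> f (measure M) = integral\<^sup>L M f"
  by (simp add: pairing_def pos_part_measure[OF assms] neg_part_measure[OF assms])

lemma total_var_measure:
  assumes "finite_measure M" "sets M = sets (borel_on \<Omega>)" "A \<in> sets (borel_on \<Omega>)"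
  shows "emeasure (total_var \<Omega> (measure M)) A = emeasure M A"
  using assms by (simp add: emeasure_total_var pos_part_measure neg_part_measure)

section \<open>Integrals of continuous functions and supports\<close>

lemma continuous_on_compact_integrable:
  fixes f :: "'a::topological_space \<Rightarrow> real"
  assumes "finite_measure M" "sets M = sets (borel_on S)" "compact S" "continuous_on S f"
  shows "integrable M f"
proof -
  interpret finite_measure M by fact
  have space: "space M = S" using sets_eq_imp_space_eq[OF assms(2)] by simp
  have "bounded (f ` S)"
    using assms by (intro compact_imp_bounded compact_continuous_image)
  then obtain B where "\<And>x. x \<in> S \<Longrightarrow> norm (f x) \<le> B"
    unfolding bounded_iff by blast
  moreover have "f \<in> borel_measurable M"
    using borel_measurable_continuous_on_restrict[OF assms(4)] assms(2)
    by (simp cong: measurable_cong_sets)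
  ultimately show ?thesis by (intro integrable_const_bound[of _ B]) (auto simp: space)
qed

text \<open>The complement of the support is null: by second countability it is covered by countably many
  basic open sets of measure zero.\<close>

lemma AE_in_msupp:
  fixes M :: "'a::second_countable_topology measure"
  assumes sets: "sets M = sets (borel_on S)"
  shows "AE x in M. x \<in> msupp M"
proof -
  have space: "space M = S" using sets_eq_imp_space_eq[OF sets] by simp
  obtain B :: "'a set set" where B: "countable B" "topological_basis B"
    using ex_countable_basis by blast
  define C where "C = {U \<in> B. emeasure M (U \<inter> S) = 0}"
  have meas: "U \<inter> S \<in> sets M" if "open U" for U
    using that unfolding sets sets_restrict_space by auto
  have "(\<Union>U\<in>C. U \<inter> S) \<in> null_sets M"
  proof (rule null_sets_UN')
    show "countable C" using B(1) by (simp add: C_def)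
    show "U \<inter> S \<in> null_sets M" if "U \<in> C" for U
      using that topological_basis_open[OF B(2)] by (auto simp: C_def intro!: null_setsI meas)
  qed
  moreover have "{x \<in> space M. x \<notin> msupp M} \<subseteq> (\<Union>U\<in>C. U \<inter> S)"
  proof safe
    fix x assume x: "x \<in> space M" "x \<notin> msupp M"
    then obtain U where U: "open U" "x \<in> U" "emeasure M (U \<inter> S) = 0"
      unfolding msupp_def space by auto
    then obtain V where V: "V \<in> B" "x \<in> V" "V \<subseteq> U"
      using topological_basisE[OF B(2)] by metis
    have "emeasure M (V \<inter> S) \<le> emeasure M (U \<inter> S)"
      using V U by (intro emeasure_mono meas) auto
    then show "x \<in> (\<Union>U\<in>C. U \<inter> S)"
      using U V x by (auto simp: C_def space)
  qed
  ultimately show ?thesis by (rule AE_I'[rotated 0])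
qed

text \<open>This turns complementary slackness into support conditions. If the integral of a nonnegative
  continuous \<open>f\<close> is zero, the open set on which \<open>f\<close> is positive is null and so misses the support;
  conversely the support carries the whole measure.\<close>

lemma integral_eq_0_iff_msupp:
  fixes f :: "'a::second_countable_topology \<Rightarrow> real"
  assumes M: "finite_measure M" "sets M = sets (borel_on S)" and S: "compact S"
    and f: "continuous_on S f" "\<And>x. x \<in> S \<Longrightarrow> 0 \<le> f x"
  shows "integral\<^sup>L M f = 0 \<longleftrightarrow> msupp M \<subseteq> {x \<in> S. f x = 0}"
proof -
  have space: "space M = S" using sets_eq_imp_space_eq[OF M(2)] by simp
  have "integrable M f"
    by (rule continuous_on_compact_integrable[OF M S f(1)])
  then have iff: "integral\<^sup>L M f = 0 \<longleftrightarrow> (AE x in M. f x = 0)"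
    using f(2) space by (intro integral_nonneg_eq_0_iff_AE) auto
  show ?thesis
  proof
    assume "integral\<^sup>L M f = 0"
    then have AE: "AE x in M. f x = 0" using iff by simp
    show "msupp M \<subseteq> {x \<in> S. f x = 0}"
    proof (rule subsetI, rule ccontr)
      fix x assume x: "x \<in> msupp M" "x \<notin> {x \<in> S. f x = 0}"
      then have xS: "x \<in> S" "f x \<noteq> 0" by (auto simp: msupp_def space)
      obtain U where U: "open U" "U \<inter> S = f -` (- {0}) \<inter> S"
        using f(1) continuous_on_open_invariant[of S f] by (metis open_Compl closed_singleton)
      have "U \<inter> S \<in> sets M" using U(1) unfolding M(2) sets_restrict_space by auto
      then have "emeasure M (U \<inter> S) = 0"
        using AE U(2) by (intro AE_iff_measurable[THEN iffD1, of _ M "\<lambda>x. f x = 0"])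
          (auto simp: space)
      moreover have "x \<in> U" using xS U(2) by blast
      ultimately show False using x(1) U(1) by (auto simp: msupp_def space)
    qed
  next
    assume "msupp M \<subseteq> {x \<in> S. f x = 0}"
    then show "integral\<^sup>L M f = 0"
      unfolding iff using AE_in_msupp[OF M(2)] by (auto elim!: eventually_mono)
  qed
qed

section \<open>Transport plans\<close>

lemma couplings_sets: "\<gamma> \<in> couplings \<Omega> \<mu> \<nu> \<Longrightarrow> sets \<gamma> = sets (borel_on (\<Omega> \<times> \<Omega>))"
  by (simp add: couplings_def)

lemma couplings_space: "\<gamma> \<in> couplings \<Omega> \<mu> \<nu> \<Longrightarrow> space \<gamma> = \<Omega> \<times> \<Omega>"
  using sets_eq_imp_space_eq[OF couplings_sets] by simp

lemma measurable_projections: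
  fixes \<gamma> :: "('a::topological_space \<times> 'a) measure"
  assumes "sets \<gamma> = sets (borel_on (\<Omega> \<times> \<Omega>))"
  shows "fst \<in> measurable \<gamma> (borel_on \<Omega>)" "snd \<in> measurable \<gamma> (borel_on \<Omega>)"
proof -
  have "fst \<in> measurable (borel_on (\<Omega> \<times> \<Omega>)) (borel_on \<Omega>)"
    by (rule measurable_restrict_space3) (auto intro!: borel_measurable_continuous_onI continuous_on_fst)
  moreover have "snd \<in> measurable (borel_on (\<Omega> \<times> \<Omega>)) (borel_on \<Omega>)"
    by (rule measurable_restrict_space3) (auto intro!: borel_measurable_continuous_onI continuous_on_snd)
  ultimately show "fst \<in> measurable \<gamma> (borel_on \<Omega>)" "snd \<in> measurable \<gamma> (borel_on \<Omega>)"
    using assms by (auto cong: measurable_cong_sets)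
qed

lemma couplings_marginals:
  assumes "\<gamma> \<in> couplings \<Omega> \<mu> \<nu>"
  shows "distr \<gamma> (borel_on \<Omega>) fst = \<mu>" "distr \<gamma> (borel_on \<Omega>) snd = \<nu>"
    "emeasure \<mu> \<Omega> = emeasure \<gamma> (\<Omega> \<times> \<Omega>)" "emeasure \<nu> \<Omega> = emeasure \<gamma> (\<Omega> \<times> \<Omega>)"
proof -
  note meas = measurable_projections[OF couplings_sets[OF assms]]
  show fst: "distr \<gamma> (borel_on \<Omega>) fst = \<mu>" and snd: "distr \<gamma> (borel_on \<Omega>) snd = \<nu>"
    using assms by (auto simp: couplings_def)
  have \<Omega>: "\<Omega> \<in> sets (borel_on \<Omega>)" using sets.top[of "borel_on \<Omega>"] by simp
  have "fst -` \<Omega> \<inter> \<Omega> \<times> \<Omega> = \<Omega> \<times> \<Omega>" "snd -` \<Omega> \<inter> \<Omega> \<times> \<Omega> = \<Omega> \<times> \<Omega>" by auto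
  then show "emeasure \<mu> \<Omega> = emeasure \<gamma> (\<Omega> \<times> \<Omega>)" "emeasure \<nu> \<Omega> = emeasure \<gamma> (\<Omega> \<times> \<Omega>)"
    unfolding fst[symmetric] snd[symmetric] using meas \<Omega>
    by (simp_all add: emeasure_distr couplings_space[OF assms])
qed

lemma couplings_finite_measure:
  assumes "\<gamma> \<in> couplings \<Omega> \<mu> \<nu>" "finite_measure \<mu>"
  shows "finite_measure \<gamma>"
proof
  have "\<mu> = distr \<gamma> (borel_on \<Omega>) fst" using couplings_marginals[OF assms(1)] by simp
  then have "space \<mu> = \<Omega>" by simp
  then show "emeasure \<gamma> (space \<gamma>) \<noteq> \<infinity>"
    using couplings_marginals(3)[OF assms(1)] finite_measure.emeasure_finite[OF assms(2), of \<Omega>]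
      couplings_space[OF assms(1)] by simp
qed

text \<open>The functional that the norm minimises, as a function of the pair \<open>(\<nu>, \<gamma>)\<close> and not of \<open>\<nu>\<close>
  alone. As \<open>\<gamma>\<close> has the mass of either Jordan part of \<open>\<nu>\<close>, the term \<open>\<beta>/2\<close> times the total
  variation of \<open>\<nu>\<close> becomes \<open>\<beta>\<close> times the mass of \<open>\<gamma>\<close>, so \<open>\<gamma>\<close> pays
  \<open>\<bar>x - y\<bar>\<^sup>p + \<beta>\<close> per unit of mass.\<close>

definition plan_cost :: "'a::real_normed_vector set \<Rightarrow> real \<Rightarrow> real \<Rightarrow> real \<Rightarrow>
    'a smeasure \<Rightarrow> 'a smeasure \<Rightarrow> ('a \<times> 'a) measure \<Rightarrow> ennreal" where
  "plan_cost \<Omega> p \<alpha> \<beta> \<mu> \<nu> \<gamma> = transport_cost p \<gamma> + ennreal \<beta> * emeasure \<gamma> (\<Omega> \<times> \<Omega>)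
     + ennreal \<alpha> * emeasure (total_var \<Omega> (\<lambda>A. \<mu> A - \<nu> A)) \<Omega>"

lemma couplings_total_var:
  assumes "\<gamma> \<in> couplings \<Omega> (pos_part \<Omega> \<nu>) (neg_part \<Omega> \<nu>)"
  shows "ennreal (\<beta> / 2) * emeasure (total_var \<Omega> \<nu>) \<Omega> = ennreal \<beta> * emeasure \<gamma> (\<Omega> \<times> \<Omega>)"
proof -
  have "emeasure (total_var \<Omega> \<nu>) \<Omega> = emeasure \<gamma> (\<Omega> \<times> \<Omega>) + emeasure \<gamma> (\<Omega> \<times> \<Omega>)"
    using sets.top[of "borel_on \<Omega>"] couplings_marginals(3,4)[OF assms]
    by (simp add: emeasure_total_var)
  then have "ennreal (\<beta> / 2) * emeasure (total_var \<Omega> \<nu>) \<Omega> =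
    (ennreal (\<beta> / 2) + ennreal (\<beta> / 2)) * emeasure \<gamma> (\<Omega> \<times> \<Omega>)"
    by (simp add: distrib_left distrib_right)
  also have "ennreal (\<beta> / 2) + ennreal (\<beta> / 2) = ennreal \<beta>"
    by (cases "0 \<le> \<beta>") (auto simp: ennreal_neg simp flip: ennreal_plus)
  finally show ?thesis .
qed

lemma KR_norm_le_plan_cost:
  assumes "\<nu> \<in> smeasures \<Omega>" "\<nu> \<Omega> = 0" "\<gamma> \<in> couplings \<Omega> (pos_part \<Omega> \<nu>) (neg_part \<Omega> \<nu>)"
  shows "KR_norm \<Omega> p \<alpha> \<beta> \<mu> \<le> plan_cost \<Omega> p \<alpha> \<beta> \<mu> \<nu> \<gamma>"
proof -
  have "KR_norm \<Omega> p \<alpha> \<beta> \<mu> \<le> Wp_beta \<Omega> p \<beta> \<nu>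
      + ennreal \<alpha> * emeasure (total_var \<Omega> (\<lambda>A. \<mu> A - \<nu> A)) \<Omega>"
    unfolding KR_norm_def by (rule INF_lower) fact
  also have "\<dots> \<le> plan_cost \<Omega> p \<alpha> \<beta> \<mu> \<nu> \<gamma>"
    unfolding plan_cost_def Wp_beta_def Wp_def couplings_total_var[OF assms(3)]
    using assms by (auto intro!: add_right_mono INF_lower)
  finally show ?thesis .
qed

text \<open>With \<open>KR_norm_le_plan_cost\<close> this says that the norm is the infimum of \<open>plan_cost\<close>; a \<open>\<nu>\<close> without
  couplings contributes the value \<open>\<infinity>\<close>.\<close>

lemma KR_norm_greatest:
  assumes "\<And>\<nu> \<gamma>. \<nu> \<in> smeasures \<Omega> \<Longrightarrow> \<gamma> \<in> couplings \<Omega> (pos_part \<Omega> \<nu>) (neg_part \<Omega> \<nu>) \<Longrightarrow>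
     c \<le> plan_cost \<Omega> p \<alpha> \<beta> \<mu> \<nu> \<gamma>"
  shows "c \<le> KR_norm \<Omega> p \<alpha> \<beta> \<mu>"
  unfolding KR_norm_def
proof (rule INF_greatest)
  fix \<nu> assume \<nu>: "\<nu> \<in> smeasures \<Omega>"
  let ?a = "ennreal (\<beta> / 2) * emeasure (total_var \<Omega> \<nu>) \<Omega>
    + ennreal \<alpha> * emeasure (total_var \<Omega> (\<lambda>A. \<mu> A - \<nu> A)) \<Omega>"
  let ?C = "couplings \<Omega> (pos_part \<Omega> \<nu>) (neg_part \<Omega> \<nu>)"
  have "c \<le> ?a + Wp \<Omega> p (pos_part \<Omega> \<nu>) (neg_part \<Omega> \<nu>)"
  proof (cases "?a = top")
    case False
    have "c - ?a \<le> Wp \<Omega> p (pos_part \<Omega> \<nu>) (neg_part \<Omega> \<nu>)"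
      unfolding Wp_def
    proof (rule INF_greatest)
      fix \<gamma> assume \<gamma>: "\<gamma> \<in> ?C"
      have "c \<le> ?a + transport_cost p \<gamma>"
        using assms[OF \<nu> \<gamma>] unfolding plan_cost_def couplings_total_var[OF \<gamma>]
        by (simp add: ac_simps)
      then show "c - ?a \<le> transport_cost p \<gamma>"
        using False by (simp only: ennreal_minus_le_iff) blast
    qed
    then show ?thesis by (simp only: ennreal_minus_le_iff)
  next
    case True
    then show ?thesis by (simp only: top_add) simp
  qed
  also have "\<dots> \<le> Wp_beta \<Omega> p \<beta> \<nu> + ennreal \<alpha> * emeasure (total_var \<Omega> (\<lambda>A. \<mu> A - \<nu> A)) \<Omega>"
    unfolding Wp_beta_def by (auto simp: ac_simps intro!: add_left_mono)
  finally show "c \<le> Wp_beta \<Omega> p \<beta> \<nu> + ennreal \<alpha> * emeasure (total_var \<Omega> (\<lambda>A. \<mu> A - \<nu> A)) \<Omega>" .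
qed

lemma continuous_on_cost:
  fixes \<Omega> :: "'a::real_normed_vector set"
  assumes "0 < p"
  shows "continuous_on (\<Omega> \<times> \<Omega>) (\<lambda>(x, y). norm (x - y) powr p)"
  unfolding case_prod_beta
  using assms by (intro continuous_on_powr' continuous_intros) auto

lemma continuous_on_slack:
  fixes \<Omega> :: "'a::real_normed_vector set"
  assumes "0 < p" "continuous_on \<Omega> q"
  shows "continuous_on (\<Omega> \<times> \<Omega>) (\<lambda>(x, y). norm (x - y) powr p + \<beta> - (q x - q y))"
  unfolding case_prod_beta
  by (intro continuous_intros continuous_on_cost[OF assms(1), unfolded case_prod_beta]
      continuous_on_compose2[OF assms(2)]) auto

text \<open>The duality gap of a plan against a potential \<open>q\<close>. By the marginal conditions the pairing of
  \<open>q\<close> with \<open>\<nu>\<close> is the integral of \<open>q x - q y\<close> against \<open>\<gamma>\<close>, and the pairing with \<open>\<mu> - \<nu>\<close> splits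
  over its Jordan parts; what remains of the cost is the sum \<open>gap\<close> of three integrals whose
  integrands are the slacks of the constraints on \<open>q\<close>.\<close>

lemma plan_cost_eq:
  fixes \<Omega> :: "'a::euclidean_space set"
  assumes \<Omega>: "compact \<Omega>" and p: "0 < p" and \<alpha>: "0 \<le> \<alpha>" and \<beta>: "0 \<le> \<beta>"
    and \<mu>: "\<mu> \<in> smeasures \<Omega>" and \<nu>: "\<nu> \<in> smeasures \<Omega>"
    and \<gamma>: "\<gamma> \<in> couplings \<Omega> (pos_part \<Omega> \<nu>) (neg_part \<Omega> \<nu>)"
    and q: "continuous_on \<Omega> q"
  defines "\<sigma> \<equiv> \<lambda>A. \<mu> A - \<nu> A"
  defines "gap \<equiv> (\<integral>(x, y). norm (x - y) powr p + \<beta> - (q x - q y) \<partial>\<gamma>)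
      + (\<integral>x. \<alpha> - q x \<partial>pos_part \<Omega> \<sigma>) + (\<integral>x. \<alpha> + q x \<partial>neg_part \<Omega> \<sigma>)"
  shows "plan_cost \<Omega> p \<alpha> \<beta> \<mu> \<nu> \<gamma> = ennreal (pairing \<Omega> q \<nu> + pairing \<Omega> q \<sigma> + gap)"
    and "0 \<le> pairing \<Omega> q \<nu> + pairing \<Omega> q \<sigma> + gap"
proof -
  have \<sigma>: "\<sigma> \<in> smeasures \<Omega>" unfolding \<sigma>_def by (rule smeasures_diff[OF \<mu> \<nu>])
  interpret P: finite_measure "pos_part \<Omega> \<sigma>" by (rule finite_measure_pos_part[OF \<sigma>])
  interpret N: finite_measure "neg_part \<Omega> \<sigma>" by (rule finite_measure_neg_part[OF \<sigma>])
  interpret G: finite_measure \<gamma>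
    by (rule couplings_finite_measure[OF \<gamma> finite_measure_pos_part[OF \<nu>]])
  note sets_\<gamma> = couplings_sets[OF \<gamma>] and space_\<gamma> = couplings_space[OF \<gamma>]
  note G_int = continuous_on_compact_integrable[OF G.finite_measure_axioms sets_\<gamma> compact_Times[OF \<Omega> \<Omega>]]
  have P_q: "integrable (pos_part \<Omega> \<sigma>) q"
    by (rule continuous_on_compact_integrable[OF P.finite_measure_axioms _ \<Omega> q]) simp
  have N_q: "integrable (neg_part \<Omega> \<sigma>) q"
    by (rule continuous_on_compact_integrable[OF N.finite_measure_axioms _ \<Omega> q]) simp
  have G_c: "integrable \<gamma> (\<lambda>(x, y). norm (x - y) powr p)"
    by (rule G_int[OF continuous_on_cost[OF p]])
  have G_fst: "integrable \<gamma> (\<lambda>z. q (fst z))" and G_snd: "integrable \<gamma> (\<lambda>z. q (snd z))"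
    by (intro G_int continuous_on_compose2[OF q] continuous_intros; auto)+
  have q_meas: "q \<in> borel_measurable (borel_on \<Omega>)"
    by (rule borel_measurable_continuous_on_restrict[OF q])
  note marg = couplings_marginals(1,2)[OF \<gamma>] and proj = measurable_projections[OF sets_\<gamma>]
  define cost where "cost = (\<integral>(x, y). norm (x - y) powr p \<partial>\<gamma>) + \<beta> * measure \<gamma> (\<Omega> \<times> \<Omega>)
      + (\<alpha> * measure (pos_part \<Omega> \<sigma>) \<Omega> + \<alpha> * measure (neg_part \<Omega> \<sigma>) \<Omega>)"
  have "pairing \<Omega> q \<nu> = (\<integral>z. q (fst z) \<partial>\<gamma>) - (\<integral>z. q (snd z) \<partial>\<gamma>)"
    unfolding pairing_def marg[symmetric] using proj q_meas by (simp add: integral_distr)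
  moreover have "pairing \<Omega> q \<sigma> = (\<integral>x. q x \<partial>pos_part \<Omega> \<sigma>) - (\<integral>x. q x \<partial>neg_part \<Omega> \<sigma>)"
    by (simp add: pairing_def)
  moreover have "(\<integral>(x, y). norm (x - y) powr p + \<beta> - (q x - q y) \<partial>\<gamma>) =
    (\<integral>(x, y). norm (x - y) powr p \<partial>\<gamma>) + \<beta> * measure \<gamma> (\<Omega> \<times> \<Omega>)
      - ((\<integral>z. q (fst z) \<partial>\<gamma>) - (\<integral>z. q (snd z) \<partial>\<gamma>))"
    using G_c G_fst G_snd unfolding case_prod_beta by (simp add: space_\<gamma>)
  moreover have "(\<integral>x. \<alpha> - q x \<partial>pos_part \<Omega> \<sigma>) = \<alpha> * measure (pos_part \<Omega> \<sigma>) \<Omega> - (\<integral>x. q x \<partial>pos_part \<Omega> \<sigma>)"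
    using P_q by simp
  moreover have "(\<integral>x. \<alpha> + q x \<partial>neg_part \<Omega> \<sigma>) = \<alpha> * measure (neg_part \<Omega> \<sigma>) \<Omega> + (\<integral>x. q x \<partial>neg_part \<Omega> \<sigma>)"
    using N_q by simp
  ultimately have eq: "pairing \<Omega> q \<nu> + pairing \<Omega> q \<sigma> + gap = cost"
    unfolding gap_def cost_def by linarith
  have c: "0 \<le> (\<integral>(x, y). norm (x - y) powr p \<partial>\<gamma>)"
    by (intro integral_nonneg_AE) auto
  then have nonneg: "0 \<le> cost" unfolding cost_def using \<alpha> \<beta> by simp
  have "transport_cost p \<gamma> = ennreal (\<integral>(x, y). norm (x - y) powr p \<partial>\<gamma>)"
    unfolding transport_cost_def case_prod_beta
    using G_c[unfolded case_prod_beta] by (intro nn_integral_eq_integral) auto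
  moreover have "emeasure (total_var \<Omega> \<sigma>) \<Omega> =
    ennreal (measure (pos_part \<Omega> \<sigma>) \<Omega> + measure (neg_part \<Omega> \<sigma>) \<Omega>)"
    using sets.top[of "borel_on \<Omega>"]
    by (simp add: emeasure_total_var P.emeasure_eq_measure N.emeasure_eq_measure)
  ultimately have "plan_cost \<Omega> p \<alpha> \<beta> \<mu> \<nu> \<gamma> = ennreal cost"
    unfolding plan_cost_def cost_def \<sigma>_def[symmetric] G.emeasure_eq_measure
    using \<alpha> \<beta> c by (simp add: ennreal_mult distrib_left)
  then show "plan_cost \<Omega> p \<alpha> \<beta> \<mu> \<nu> \<gamma> = ennreal (pairing \<Omega> q \<nu> + pairing \<Omega> q \<sigma> + gap)"
    and "0 \<le> pairing \<Omega> q \<nu> + pairing \<Omega> q \<sigma> + gap"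
    unfolding eq using nonneg by simp_all
qed

text \<open>Under the constraints the three integrals of the gap
  are nonnegative, so the pairing is a lower bound; it is attained exactly if all three vanish,
  that is, if each measure lives where the corresponding constraint is active.\<close>

lemma plan_cost_duality:
  fixes \<Omega> :: "'a::euclidean_space set"
  assumes \<Omega>: "compact \<Omega>" and p: "0 < p" and \<alpha>: "0 \<le> \<alpha>" and \<beta>: "0 \<le> \<beta>"
    and \<mu>: "\<mu> \<in> smeasures \<Omega>" and \<nu>: "\<nu> \<in> smeasures \<Omega>"
    and \<gamma>: "\<gamma> \<in> couplings \<Omega> (pos_part \<Omega> \<nu>) (neg_part \<Omega> \<nu>)"
    and q: "continuous_on \<Omega> q" "\<And>x. x \<in> \<Omega> \<Longrightarrow> \<bar>q x\<bar> \<le> \<alpha>"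
      "\<And>x y. x \<in> \<Omega> \<Longrightarrow> y \<in> \<Omega> \<Longrightarrow> q x - q y \<le> norm (x - y) powr p + \<beta>"
  defines "\<sigma> \<equiv> \<lambda>A. \<mu> A - \<nu> A"
  shows "ennreal (pairing \<Omega> q \<nu> + pairing \<Omega> q \<sigma>) \<le> plan_cost \<Omega> p \<alpha> \<beta> \<mu> \<nu> \<gamma>" (is ?lower)
    and "plan_cost \<Omega> p \<alpha> \<beta> \<mu> \<nu> \<gamma> = ennreal r \<Longrightarrow> 0 \<le> r \<Longrightarrow>
      r \<le> pairing \<Omega> q \<nu> + pairing \<Omega> q \<sigma> \<longleftrightarrow>
        msupp (pos_part \<Omega> \<sigma>) \<subseteq> {x \<in> \<Omega>. q x = \<alpha>} \<and>
        msupp (neg_part \<Omega> \<sigma>) \<subseteq> {x \<in> \<Omega>. q x = - \<alpha>} \<and>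
        msupp \<gamma> \<subseteq> {(x, y) \<in> \<Omega> \<times> \<Omega>. q x - q y = norm (x - y) powr p + \<beta>}"
      (is "_ \<Longrightarrow> _ \<Longrightarrow> ?tight")
    and "plan_cost \<Omega> p \<alpha> \<beta> \<mu> \<nu> \<gamma> = ennreal r \<Longrightarrow> 0 \<le> r \<Longrightarrow> pairing \<Omega> q \<nu> + pairing \<Omega> q \<sigma> \<le> r"
      (is "_ \<Longrightarrow> _ \<Longrightarrow> ?le")
proof -
  have \<sigma>: "\<sigma> \<in> smeasures \<Omega>" unfolding \<sigma>_def by (rule smeasures_diff[OF \<mu> \<nu>])
  define s where "s = (\<lambda>(x, y). norm (x - y) powr p + \<beta> - (q x - q y))"
  define a where "a = integral\<^sup>L \<gamma> s"
  define b where "b = (\<integral>x. \<alpha> - q x \<partial>pos_part \<Omega> \<sigma>)"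
  define c where "c = (\<integral>x. \<alpha> + q x \<partial>neg_part \<Omega> \<sigma>)"
  have s: "0 \<le> s z" if "z \<in> \<Omega> \<times> \<Omega>" for z
    using that q(3) by (auto simp: s_def)
  have q': "q x \<le> \<alpha>" "- \<alpha> \<le> q x" if "x \<in> \<Omega>" for x
    using q(2)[OF that] by linarith+
  have a0: "0 \<le> a" unfolding a_def
    using s by (intro integral_nonneg_AE) (auto simp: couplings_space[OF \<gamma>])
  have b0: "0 \<le> b" unfolding b_def
    using q' by (intro integral_nonneg_AE) auto
  have c0: "0 \<le> c" unfolding c_def
    using q' by (intro integral_nonneg_AE AE_I2) (simp, smt (verit))
  have cost: "plan_cost \<Omega> p \<alpha> \<beta> \<mu> \<nu> \<gamma> = ennreal (pairing \<Omega> q \<nu> + pairing \<Omega> q \<sigma> + (a + b + c))"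
    "0 \<le> pairing \<Omega> q \<nu> + pairing \<Omega> q \<sigma> + (a + b + c)"
    using plan_cost_eq[OF \<Omega> p \<alpha> \<beta> \<mu> \<nu> \<gamma> q(1)]
    unfolding a_def b_def c_def s_def \<sigma>_def by simp_all
  show ?lower unfolding cost using a0 b0 c0 by (intro ennreal_leI) simp
  have r: "r = pairing \<Omega> q \<nu> + pairing \<Omega> q \<sigma> + (a + b + c)"
    if "plan_cost \<Omega> p \<alpha> \<beta> \<mu> \<nu> \<gamma> = ennreal r" "0 \<le> r"
    using that cost by simp
  show ?le if "plan_cost \<Omega> p \<alpha> \<beta> \<mu> \<nu> \<gamma> = ennreal r" "0 \<le> r"
    using r[OF that] a0 b0 c0 by simp
  have "continuous_on (\<Omega> \<times> \<Omega>) s"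
    unfolding s_def by (rule continuous_on_slack[OF p q(1)])
  then have "a = 0 \<longleftrightarrow> msupp \<gamma> \<subseteq> {z \<in> \<Omega> \<times> \<Omega>. s z = 0}"
    unfolding a_def using s couplings_sets[OF \<gamma>] compact_Times[OF \<Omega> \<Omega>]
      couplings_finite_measure[OF \<gamma> finite_measure_pos_part[OF \<nu>]]
    by (intro integral_eq_0_iff_msupp) auto
  also have "{z \<in> \<Omega> \<times> \<Omega>. s z = 0} = {(x, y) \<in> \<Omega> \<times> \<Omega>. q x - q y = norm (x - y) powr p + \<beta>}"
    by (auto simp: s_def)
  finally have a_iff: "a = 0 \<longleftrightarrow> msupp \<gamma> \<subseteq> {(x, y) \<in> \<Omega> \<times> \<Omega>. q x - q y = norm (x - y) powr p + \<beta>}" .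
  have "b = 0 \<longleftrightarrow> msupp (pos_part \<Omega> \<sigma>) \<subseteq> {x \<in> \<Omega>. \<alpha> - q x = 0}"
    unfolding b_def using q' \<Omega> q(1) finite_measure_pos_part[OF \<sigma>]
    by (intro integral_eq_0_iff_msupp) (auto intro!: continuous_intros)
  also have "{x \<in> \<Omega>. \<alpha> - q x = 0} = {x \<in> \<Omega>. q x = \<alpha>}" by auto
  finally have b_iff: "b = 0 \<longleftrightarrow> msupp (pos_part \<Omega> \<sigma>) \<subseteq> {x \<in> \<Omega>. q x = \<alpha>}" .
  have "0 \<le> \<alpha> + q x" if "x \<in> \<Omega>" for x using q'(2)[OF that] by simp
  then have "c = 0 \<longleftrightarrow> msupp (neg_part \<Omega> \<sigma>) \<subseteq> {x \<in> \<Omega>. \<alpha> + q x = 0}"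
    unfolding c_def using \<Omega> q(1) finite_measure_neg_part[OF \<sigma>]
    by (intro integral_eq_0_iff_msupp) (auto intro!: continuous_intros)
  also have "{x \<in> \<Omega>. \<alpha> + q x = 0} = {x \<in> \<Omega>. q x = - \<alpha>}" by auto
  finally have c_iff: "c = 0 \<longleftrightarrow> msupp (neg_part \<Omega> \<sigma>) \<subseteq> {x \<in> \<Omega>. q x = - \<alpha>}" .
  show ?tight if "plan_cost \<Omega> p \<alpha> \<beta> \<mu> \<nu> \<gamma> = ennreal r" "0 \<le> r"
    unfolding a_iff[symmetric] b_iff[symmetric] c_iff[symmetric] r[OF that]
    using a0 b0 c0 by (smt (verit))
qed

section \<open>Perturbations of a transport plan\<close>

lemma distr_scale_measure:
  assumes "f \<in> measurable M N"
  shows "distr (scale_measure r M) N f = scale_measure r (distr M N f)"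
  using assms by (intro measure_eqI) (auto simp: emeasure_distr space_scale_measure)

lemma distr_sum_measure:
  assumes "sets M' = sets M" "f \<in> measurable M N"
  shows "distr (sum_measure M M') N f = sum_measure (distr M N f) (distr M' N f)"
proof (rule measure_eqI)
  fix A assume A: "A \<in> sets (distr (sum_measure M M') N f)"
  have f: "f \<in> measurable M' N" "f \<in> measurable (sum_measure M M') N"
    using assms by (simp_all cong: measurable_cong_sets)
  have "space M' = space M" by (rule sets_eq_imp_space_eq[OF assms(1)])
  then show "emeasure (distr (sum_measure M M') N f) A =
      emeasure (sum_measure (distr M N f) (distr M' N f)) A"
    using A assms f measurable_sets[OF assms(2), of A]
    by (simp add: emeasure_distr emeasure_sum_measure)
qed simp

lemma borel_measurable_cost:
  fixes \<Omega> :: "'a::real_normed_vector set"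
  assumes "0 < p"
  shows "(\<lambda>(x, y). ennreal (norm (x - y) powr p)) \<in> borel_measurable (borel_on (\<Omega> \<times> \<Omega>))"
  using borel_measurable_continuous_on_restrict[OF continuous_on_cost[OF assms, of \<Omega>]]
  unfolding case_prod_beta by measurable

lemma plan_cost_scale:
  fixes \<Omega> :: "'a::euclidean_space set"
  assumes p: "0 < p" and \<mu>: "\<mu> \<in> smeasures \<Omega>" and \<nu>: "\<nu> \<in> smeasures \<Omega>"
    and \<gamma>: "\<gamma> \<in> couplings \<Omega> (pos_part \<Omega> \<nu>) (neg_part \<Omega> \<nu>)" and c: "0 \<le> c"
  shows "scale_measure (ennreal c) \<gamma> \<in>
      couplings \<Omega> (pos_part \<Omega> (\<lambda>A. c * \<nu> A)) (neg_part \<Omega> (\<lambda>A. c * \<nu> A))"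
    and "plan_cost \<Omega> p \<alpha> \<beta> (\<lambda>A. c * \<mu> A) (\<lambda>A. c * \<nu> A) (scale_measure (ennreal c) \<gamma>) =
      ennreal c * plan_cost \<Omega> p \<alpha> \<beta> \<mu> \<nu> \<gamma>"
proof -
  note sets = couplings_sets[OF \<gamma>] and marg = couplings_marginals(1,2)[OF \<gamma>]
  show "scale_measure (ennreal c) \<gamma> \<in>
      couplings \<Omega> (pos_part \<Omega> (\<lambda>A. c * \<nu> A)) (neg_part \<Omega> (\<lambda>A. c * \<nu> A))"
    unfolding couplings_def pos_part_cmult[OF \<nu> c] neg_part_cmult[OF \<nu> c]
    using sets marg by (simp add: distr_scale_measure measurable_projections)
  have "transport_cost p (scale_measure (ennreal c) \<gamma>) = ennreal c * transport_cost p \<gamma>"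
    unfolding transport_cost_def using borel_measurable_cost[OF p, of \<Omega>] sets
    by (intro nn_integral_scale_measure) (simp cong: measurable_cong_sets)
  moreover have "emeasure (total_var \<Omega> (\<lambda>A. c * \<mu> A - c * \<nu> A)) \<Omega> =
    ennreal c * emeasure (total_var \<Omega> (\<lambda>A. \<mu> A - \<nu> A)) \<Omega>"
    using total_var_cmult[OF smeasures_diff[OF \<mu> \<nu>] c, of \<Omega>] sets.top[of "borel_on \<Omega>"]
    by (simp add: right_diff_distrib)
  ultimately show "plan_cost \<Omega> p \<alpha> \<beta> (\<lambda>A. c * \<mu> A) (\<lambda>A. c * \<nu> A) (scale_measure (ennreal c) \<gamma>) =
      ennreal c * plan_cost \<Omega> p \<alpha> \<beta> \<mu> \<nu> \<gamma>"
    by (simp add: plan_cost_def distrib_left mult.left_commute)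
qed

text \<open>A perturbation \<open>\<tau>\<close> of \<open>\<mu>\<close> can be left entirely to the variation term, with \<open>\<nu>\<close> and \<open>\<gamma>\<close> kept.\<close>

lemma plan_cost_add_le:
  assumes "\<mu> \<in> smeasures \<Omega>" "\<nu> \<in> smeasures \<Omega>" "\<tau> \<in> smeasures \<Omega>"
  shows "plan_cost \<Omega> p \<alpha> \<beta> (\<lambda>A. \<mu> A + \<tau> A) \<nu> \<gamma>
    \<le> plan_cost \<Omega> p \<alpha> \<beta> \<mu> \<nu> \<gamma> + ennreal \<alpha> * emeasure (total_var \<Omega> \<tau>) \<Omega>"
proof -
  have eq: "(\<lambda>A. \<mu> A + \<tau> A - \<nu> A) = (\<lambda>A. (\<mu> A - \<nu> A) + \<tau> A)" by auto
  have "emeasure (total_var \<Omega> (\<lambda>A. \<mu> A + \<tau> A - \<nu> A)) \<Omega>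
    \<le> emeasure (total_var \<Omega> (\<lambda>A. \<mu> A - \<nu> A)) \<Omega> + emeasure (total_var \<Omega> \<tau>) \<Omega>"
    unfolding eq using assms sets.top[of "borel_on \<Omega>"]
    by (intro total_var_add_le smeasures_diff) auto
  from mult_left_mono[OF this, of "ennreal \<alpha>"] show ?thesis
    unfolding plan_cost_def by (simp add: distrib_left add.assoc add_left_mono)
qed

text \<open>\<^const>\<open>measure\<close> vanishes off the measurable sets, as the normalisation of signed measures
  demands.\<close>

definition dirac :: "'a::topological_space set \<Rightarrow> 'a \<Rightarrow> 'a smeasure" where
  "dirac \<Omega> x = measure (return (borel_on \<Omega>) x)"

lemma finite_measure_return: "x \<in> space M \<Longrightarrow> finite_measure (return M x)"
  by (rule prob_space.finite_measure) (rule prob_space_return)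

lemma dirac_in_smeasures: "x \<in> \<Omega> \<Longrightarrow> dirac \<Omega> x \<in> smeasures \<Omega>"
  unfolding dirac_def by (intro measure_in_smeasures finite_measure_return) auto

lemma dirac_apply: "A \<in> sets (borel_on \<Omega>) \<Longrightarrow> dirac \<Omega> x A = indicator A x"
  by (simp add: dirac_def measure_return)

lemma pairing_dirac:
  assumes "x \<in> \<Omega>" "continuous_on \<Omega> f"
  shows "pairing \<Omega> f (dirac \<Omega> x) = f x"
proof -
  have "f \<in> borel_measurable (borel_on \<Omega>)"
    by (rule borel_measurable_continuous_on_restrict[OF assms(2)])
  then show ?thesis
    unfolding dirac_def using assms
    by (simp add: pairing_measure finite_measure_return integral_return)
qed

lemma total_var_dirac:
  assumes "x \<in> \<Omega>"
  shows "emeasure (total_var \<Omega> (dirac \<Omega> x)) \<Omega> = 1"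
  unfolding dirac_def using assms sets.top[of "borel_on \<Omega>"]
  by (simp add: total_var_measure finite_measure_return)

lemma smeasures_insert_null:
  assumes "\<nu> \<in> smeasures \<Omega>" "{x} \<in> sets (borel_on \<Omega>)" "\<nu> {x} = 0" "B \<in> sets (borel_on \<Omega>)"
  shows "\<nu> (insert x B) = \<nu> B" "\<nu> (B - {x}) = \<nu> B"
proof -
  have "\<nu> {x} + \<nu> (B - {x}) = \<nu> (insert x B)"
    using smeasures_Un[of \<nu> \<Omega> "{x}" "B - {x}"] assms by (simp add: sets.Diff)
  moreover have "\<nu> (B - {x}) = \<nu> B"
    using smeasures_Diff[of \<nu> \<Omega> B "{x}"] assms by (cases "x \<in> B") auto
  ultimately show "\<nu> (insert x B) = \<nu> B" "\<nu> (B - {x}) = \<nu> B" using assms(3) by auto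
qed

text \<open>At two points that are not atoms of \<open>\<nu>\<close> there is nothing to cancel: the Jordan parts of the
  perturbed measure are those of \<open>\<nu>\<close> plus one point mass each. At an atom of the opposite sign
  this fails, and the perturbed plan would have to be rerouted.\<close>

lemma pos_part_add_dipole:
  fixes \<Omega> :: "'a::t1_space set"
  assumes \<nu>: "\<nu> \<in> smeasures \<Omega>" and x: "x \<in> \<Omega>" "\<nu> {x} = 0" and y: "y \<in> \<Omega>" "\<nu> {y} = 0"
    and xy: "x \<noteq> y" and t: "0 \<le> t"
  shows "pos_part \<Omega> (\<lambda>A. \<nu> A + t * (dirac \<Omega> x A - dirac \<Omega> y A)) =
    sum_measure (pos_part \<Omega> \<nu>) (scale_measure (ennreal t) (return (borel_on \<Omega>) x))"
    (is "pos_part \<Omega> ?\<nu>' = ?M")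
proof (rule measure_eqI)
  let ?S = "sets (borel_on \<Omega>)"
  fix A assume "A \<in> sets (pos_part \<Omega> ?\<nu>')"
  then have A: "A \<in> ?S" by simp
  have single: "{z} \<in> ?S" if "z \<in> \<Omega>" for z
    using that by (auto simp: sets_restrict_space image_iff intro!: bexI[of _ "{z}"])
  have \<nu>': "?\<nu>' \<in> smeasures \<Omega>"
    by (intro smeasures_add smeasures_cmult smeasures_diff dirac_in_smeasures \<nu> x y)
  have "upper_variation \<Omega> ?\<nu>' A = upper_variation \<Omega> \<nu> A + ennreal (t * indicator A x)"
  proof (rule antisym)
    show "upper_variation \<Omega> ?\<nu>' A \<le> upper_variation \<Omega> \<nu> A + ennreal (t * indicator A x)"
    proof (rule SUP_least, safe)
      fix B assume B: "B \<in> ?S" "B \<subseteq> A"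
      have "?\<nu>' B \<le> \<nu> B + t * indicator A x"
        using B t by (auto simp: dirac_apply indicator_def)
      then have "ennreal (?\<nu>' B) \<le> ennreal (\<nu> B) + ennreal (t * indicator A x)"
        by (intro order_trans[OF ennreal_leI ennreal_add_le])
      also have "\<dots> \<le> upper_variation \<Omega> \<nu> A + ennreal (t * indicator A x)"
        using B by (intro add_right_mono SUP_upper) auto
      finally show "ennreal (?\<nu>' B) \<le> upper_variation \<Omega> \<nu> A + ennreal (t * indicator A x)" .
    qed
    have "ennreal (\<nu> B) + ennreal (t * indicator A x) \<le> upper_variation \<Omega> ?\<nu>' A"
      if B: "B \<in> ?S" "B \<subseteq> A" for B
    proof -
      define C where "C = (if 0 \<le> \<nu> B then B else {})"
      have C: "C \<in> ?S" "C \<subseteq> A" "0 \<le> \<nu> C" "ennreal (\<nu> B) = ennreal (\<nu> C)"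
        using B \<nu> by (auto simp: C_def ennreal_neg)
      \<comment> \<open>The competitor gains \<open>x\<close>, if \<open>A\<close> contains it, and loses \<open>y\<close>; both are \<open>\<nu>\<close>-null.\<close>
      define D where "D = (if x \<in> A then insert x C else C) - {y}"
      have ins: "insert x C \<in> ?S" using single[OF x(1)] C(1) by (metis insert_is_Un sets.Un)
      have D: "D \<in> ?S" "D \<subseteq> A"
        using C ins single[OF y(1)] by (auto simp: D_def)
      have "\<nu> D = \<nu> C"
        unfolding D_def using smeasures_insert_null[OF \<nu> single] C(1) ins x y by auto
      moreover have "dirac \<Omega> x D = indicator A x" "dirac \<Omega> y D = 0"
        using D C xy by (auto simp: dirac_apply D_def indicator_def)
      ultimately have "?\<nu>' D = \<nu> C + t * indicator A x" by simp
      then have "ennreal (\<nu> B) + ennreal (t * indicator A x) = ennreal (?\<nu>' D)"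
        using C t by simp
      also have "\<dots> \<le> upper_variation \<Omega> ?\<nu>' A" using D by (intro SUP_upper) auto
      finally show ?thesis .
    qed
    then show "upper_variation \<Omega> \<nu> A + ennreal (t * indicator A x) \<le> upper_variation \<Omega> ?\<nu>' A"
      by (subst ennreal_SUP_add_left[symmetric]) (auto intro!: SUP_least)
  qed
  then show "emeasure (pos_part \<Omega> ?\<nu>') A = emeasure ?M A"
    using A t
    by (simp add: emeasure_pos_part \<nu> \<nu>' emeasure_sum_measure ennreal_mult' indicator_def)
qed simp

text \<open>Adding the dipole to \<open>\<mu>\<close> and to \<open>\<nu>\<close> leaves \<open>\<mu> - \<nu>\<close> unchanged, and the extra mass \<open>t\<close> is shipped
  straight from \<open>x\<close> to \<open>y\<close>.\<close>

lemma plan_cost_add_dipole: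
  fixes \<Omega> :: "'a::euclidean_space set"
  assumes p: "0 < p" and \<nu>: "\<nu> \<in> smeasures \<Omega>"
    and \<gamma>: "\<gamma> \<in> couplings \<Omega> (pos_part \<Omega> \<nu>) (neg_part \<Omega> \<nu>)"
    and x: "x \<in> \<Omega>" "\<nu> {x} = 0" and y: "y \<in> \<Omega>" "\<nu> {y} = 0"
    and xy: "x \<noteq> y" and t: "0 \<le> t" and \<beta>: "0 \<le> \<beta>"
  defines "\<tau> \<equiv> \<lambda>A. dirac \<Omega> x A - dirac \<Omega> y A"
    and "\<gamma>' \<equiv> sum_measure \<gamma> (scale_measure (ennreal t) (return (borel_on (\<Omega> \<times> \<Omega>)) (x, y)))"
  shows "\<gamma>' \<in> couplings \<Omega> (pos_part \<Omega> (\<lambda>A. \<nu> A + t * \<tau> A)) (neg_part \<Omega> (\<lambda>A. \<nu> A + t * \<tau> A))"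
    and "plan_cost \<Omega> p \<alpha> \<beta> (\<lambda>A. \<mu> A + t * \<tau> A) (\<lambda>A. \<nu> A + t * \<tau> A) \<gamma>' =
      plan_cost \<Omega> p \<alpha> \<beta> \<mu> \<nu> \<gamma> + ennreal (t * (norm (x - y) powr p + \<beta>))"
proof -
  note sets = couplings_sets[OF \<gamma>] and marg = couplings_marginals(1,2)[OF \<gamma>]
  let ?R = "return (borel_on (\<Omega> \<times> \<Omega>)) (x, y)"
  have pos: "pos_part \<Omega> (\<lambda>A. \<nu> A + t * \<tau> A) =
    sum_measure (pos_part \<Omega> \<nu>) (scale_measure (ennreal t) (return (borel_on \<Omega>) x))"
    unfolding \<tau>_def by (rule pos_part_add_dipole[OF \<nu> x y xy t])
  have "pos_part \<Omega> (\<lambda>A. - \<nu> A + t * (dirac \<Omega> y A - dirac \<Omega> x A)) =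
    sum_measure (pos_part \<Omega> (\<lambda>A. - \<nu> A)) (scale_measure (ennreal t) (return (borel_on \<Omega>) y))"
    using x y xy t by (intro pos_part_add_dipole smeasures_uminus \<nu>) auto
  moreover have "(\<lambda>A. - \<nu> A + t * (dirac \<Omega> y A - dirac \<Omega> x A)) = (\<lambda>A. - (\<nu> A + t * \<tau> A))"
    by (auto simp: \<tau>_def algebra_simps)
  ultimately have neg: "neg_part \<Omega> (\<lambda>A. \<nu> A + t * \<tau> A) =
    sum_measure (neg_part \<Omega> \<nu>) (scale_measure (ennreal t) (return (borel_on \<Omega>) y))"
    by (simp add: neg_part_def)
  have "fst \<in> measurable (borel_on (\<Omega> \<times> \<Omega>)) (borel_on \<Omega>)"
    "snd \<in> measurable (borel_on (\<Omega> \<times> \<Omega>)) (borel_on \<Omega>)"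
    by (rule measurable_projections; simp)+
  then have "distr ?R (borel_on \<Omega>) fst = return (borel_on \<Omega>) x"
    "distr ?R (borel_on \<Omega>) snd = return (borel_on \<Omega>) y"
    using x y by (simp_all add: distr_return)
  then show "\<gamma>' \<in> couplings \<Omega> (pos_part \<Omega> (\<lambda>A. \<nu> A + t * \<tau> A)) (neg_part \<Omega> (\<lambda>A. \<nu> A + t * \<tau> A))"
    unfolding couplings_def \<gamma>'_def pos neg
    using sets marg measurable_projections[OF sets] measurable_projections[of ?R \<Omega>]
    by (simp add: distr_sum_measure distr_scale_measure)
  note meas = borel_measurable_cost[OF p, of \<Omega>]
  have "transport_cost p \<gamma>' = transport_cost p \<gamma> + ennreal t * ennreal (norm (x - y) powr p)"
  proof -
    have "transport_cost p ?R = ennreal (norm (x - y) powr p)"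
      unfolding transport_cost_def using meas x y by (subst nn_integral_return) auto
    moreover have "transport_cost p (scale_measure (ennreal t) ?R) = ennreal t * transport_cost p ?R"
      unfolding transport_cost_def using meas by (intro nn_integral_scale_measure) simp
    moreover have "transport_cost p \<gamma>' = transport_cost p \<gamma> + transport_cost p (scale_measure (ennreal t) ?R)"
      unfolding transport_cost_def \<gamma>'_def using meas sets
      by (intro nn_integral_sum_measure) (simp_all cong: measurable_cong_sets)
    ultimately show ?thesis by simp
  qed
  moreover have "emeasure \<gamma>' (\<Omega> \<times> \<Omega>) = emeasure \<gamma> (\<Omega> \<times> \<Omega>) + ennreal t"
    unfolding \<gamma>'_def using sets sets.top[of "borel_on (\<Omega> \<times> \<Omega>)"] x y
    by (simp add: emeasure_sum_measure)
  ultimately show "plan_cost \<Omega> p \<alpha> \<beta> (\<lambda>A. \<mu> A + t * \<tau> A) (\<lambda>A. \<nu> A + t * \<tau> A) \<gamma>' =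
      plan_cost \<Omega> p \<alpha> \<beta> \<mu> \<nu> \<gamma> + ennreal (t * (norm (x - y) powr p + \<beta>))"
    unfolding plan_cost_def using t \<beta>
    by (simp add: distrib_left ennreal_mult ac_simps)
qed

lemma countable_atoms:
  fixes \<Omega> :: "'a::t1_space set"
  assumes \<nu>: "\<nu> \<in> smeasures \<Omega>"
  shows "countable {x. \<nu> {x} \<noteq> 0}"
proof -
  have "\<nu> {x} = 0" if "measure (pos_part \<Omega> \<nu>) {x} = 0" "measure (neg_part \<Omega> \<nu>) {x} = 0" for x
  proof (cases "{x} \<in> sets (borel_on \<Omega>)")
    case True
    then show ?thesis using jordan_decomposition[OF \<nu> True] that by simp
  next
    case False
    then show ?thesis using \<nu> by (auto simp: smeasures_def)
  qed
  then have "{x. \<nu> {x} \<noteq> 0} \<subseteq>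
    {x. measure (pos_part \<Omega> \<nu>) {x} \<noteq> 0} \<union> {x. measure (neg_part \<Omega> \<nu>) {x} \<noteq> 0}"
    by blast
  then show ?thesis
    by (rule countable_subset)
      (intro countable_Un finite_measure.countable_support finite_measure_pos_part finite_measure_neg_part \<nu>)
qed

text \<open>Near each of its points a convex set with more than one point contains a nondegenerate connected
  set, which is uncountable. Removing the atoms of a signed measure therefore leaves a dense set.\<close>

lemma convex_closure_minus_countable:
  fixes S :: "'a::real_normed_vector set"
  assumes S: "convex S" "a \<in> S" "b \<in> S" "a \<noteq> b" and C: "countable C"
  shows "S \<subseteq> closure (S - C)"
proof
  fix x assume x: "x \<in> S"
  have "x islimpt S"
    using S x by (intro connected_imp_perfect convex_connected) auto
  show "x \<in> closure (S - C)"
    unfolding closure_approachable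
  proof (intro allI impI)
    fix e :: real assume "0 < e"
    then obtain y where y: "y \<in> S" "y \<noteq> x" "dist y x < e"
      using \<open>x islimpt S\<close> unfolding islimpt_approachable by blast
    have "connected (S \<inter> ball x e)"
      by (intro convex_connected convex_Int S convex_ball)
    then have "uncountable (S \<inter> ball x e)"
      using x y \<open>0 < e\<close> by (intro connected_uncountable[of _ x y]) (auto simp: dist_commute)
    then have "\<not> S \<inter> ball x e \<subseteq> C" using C countable_subset by blast
    then show "\<exists>y\<in>S - C. dist y x < e" by (auto simp: dist_commute)
  qed
qed

section \<open>Differentiable convex functions\<close>

lemma GDERIV_directional:
  fixes F :: "'b::real_inner \<Rightarrow> real"
  assumes "GDERIV F v :> D"
  shows "((\<lambda>t. (F (v + t *\<^sub>R w) - F v) / t) \<longlongrightarrow> D \<bullet> w) (at_right 0)"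
proof -
  have "((\<lambda>t. v + t *\<^sub>R w) has_derivative (\<lambda>t. t *\<^sub>R w)) (at 0)"
    by (auto intro!: derivative_eq_intros)
  moreover have "(F has_derivative (\<lambda>h. h \<bullet> D)) (at (v + 0 *\<^sub>R w))"
    using assms by (simp add: gderiv_def)
  ultimately have "((\<lambda>t. F (v + t *\<^sub>R w)) has_derivative (\<lambda>t. (t *\<^sub>R w) \<bullet> D)) (at 0)"
    by (rule has_derivative_compose)
  then have "((\<lambda>t. F (v + t *\<^sub>R w)) has_real_derivative D \<bullet> w) (at 0)"
    by (rule has_derivative_imp_has_field_derivative) (simp add: inner_commute)
  then have "((\<lambda>t. (F (v + t *\<^sub>R w) - F v) / t) \<longlongrightarrow> D \<bullet> w) (at 0)"
    by (simp add: DERIV_def)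
  then show ?thesis by (rule tendsto_within_subset) auto
qed

text \<open>By convexity the difference quotients at \<open>v\<close> towards \<open>u\<close> are at most \<open>F u - F v\<close>.\<close>

lemma strictly_convex_gradient_le:
  fixes F :: "'b::real_inner \<Rightarrow> real"
  assumes F: "strictly_convex F" and D: "GDERIV F v :> D"
  shows "F v + D \<bullet> (u - v) \<le> F u"
proof (cases "u = v")
  case False
  have "(F (v + t *\<^sub>R (u - v)) - F v) / t \<le> F u - F v" if t: "0 < t" "t < 1" for t
  proof -
    have "v + t *\<^sub>R (u - v) = (1 - t) *\<^sub>R v + t *\<^sub>R u" by (simp add: algebra_simps)
    then have "F (v + t *\<^sub>R (u - v)) < (1 - t) * F v + t * F u"
      using F False t unfolding strictly_convex_def by metis
    then show ?thesis using t by (simp add: field_simps)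
  qed
  then have "eventually (\<lambda>t. (F (v + t *\<^sub>R (u - v)) - F v) / t \<le> F u - F v) (at_right 0)"
    unfolding eventually_at_right_field by (intro exI[of _ 1]) auto
  then have "D \<bullet> (u - v) \<le> F u - F v"
    by (intro tendsto_upperbound[OF GDERIV_directional[OF D]]) auto
  then show ?thesis by simp
qed simp

section \<open>First-order optimality\<close>

lemma pairing_uminus: "pairing \<Omega> (\<lambda>x. - f x) \<nu> = - pairing \<Omega> f \<nu>"
  by (simp add: pairing_def)

lemma pairing_uminus_measure: "pairing \<Omega> f (\<lambda>A. - \<nu> A) = - pairing \<Omega> f \<nu>"
  by (simp add: pairing_def neg_part_def)

lemma linear_on_smeasures_diff:
  assumes K: "linear_on_smeasures \<Omega> K" and \<mu>: "\<mu> \<in> smeasures \<Omega>" and \<nu>: "\<nu> \<in> smeasures \<Omega>"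
  shows "K (\<lambda>A. \<mu> A - \<nu> A) = K \<mu> - K \<nu>"
proof -
  have "\<forall>\<mu>\<in>smeasures \<Omega>. \<forall>\<nu>\<in>smeasures \<Omega>. K (\<lambda>A. \<mu> A + \<nu> A) = K \<mu> + K \<nu>"
    using K by (simp add: linear_on_smeasures_def)
  from bspec[OF bspec[OF this \<nu>] smeasures_diff[OF \<mu> \<nu>]] show ?thesis by simp
qed

lemma pairing_preadjoint_diff:
  assumes K: "linear_on_smeasures \<Omega> K" "is_preadjoint \<Omega> K Kpre"
    and \<mu>: "\<mu> \<in> smeasures \<Omega>" and \<nu>: "\<nu> \<in> smeasures \<Omega>"
  shows "pairing \<Omega> (\<lambda>x. - Kpre v x) (\<lambda>A. \<mu> A - \<nu> A) =
    pairing \<Omega> (\<lambda>x. - Kpre v x) \<mu> - pairing \<Omega> (\<lambda>x. - Kpre v x) \<nu>"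
  using K(2) \<mu> \<nu> smeasures_diff[OF \<mu> \<nu>]
  by (simp add: pairing_uminus is_preadjoint_def linear_on_smeasures_diff[OF K(1)] inner_diff_right)

text \<open>The tool by which minimality is exploited: an upper bound, linear in \<open>t\<close>, for the norm along a
  ray is compared with the derivative of \<open>F \<circ> K\<close> along this ray. The assumption
  \<open>- r \<le> c\<close> keeps \<open>r + t * c\<close> nonnegative, so that \<open>ennreal\<close> does not truncate it.\<close>

lemma arg_min_pairing_le:
  fixes K :: "'a::real_normed_vector smeasure \<Rightarrow> 'y::real_inner"
  assumes min: "is_arg_min (objective \<Omega> p \<alpha> \<beta> F K) (\<lambda>\<mu>. \<mu> \<in> smeasures \<Omega>) \<mu>"
    and K: "linear_on_smeasures \<Omega> K" "is_preadjoint \<Omega> K Kpre" and D: "GDERIV F (K \<mu>) :> D"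
    and r: "KR_norm \<Omega> p \<alpha> \<beta> \<mu> = ennreal r" "0 \<le> r" and c: "- r \<le> c"
    and \<eta>: "\<eta> \<in> smeasures \<Omega>"
    and le: "\<And>t. 0 < t \<Longrightarrow> t < 1 \<Longrightarrow> KR_norm \<Omega> p \<alpha> \<beta> (\<lambda>A. \<mu> A + t * \<eta> A) \<le> ennreal (r + t * c)"
  shows "pairing \<Omega> (\<lambda>x. - Kpre D x) \<eta> \<le> c"
proof -
  have \<mu>: "\<mu> \<in> smeasures \<Omega>" using min by (simp add: is_arg_min_def)
  have "- c \<le> (F (K \<mu> + t *\<^sub>R K \<eta>) - F (K \<mu>)) / t" if t: "0 < t" "t < 1" for t
  proof -
    let ?\<mu>t = "\<lambda>A. \<mu> A + t * \<eta> A"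
    have "?\<mu>t \<in> smeasures \<Omega>" by (intro smeasures_add smeasures_cmult \<mu> \<eta>)
    then have "objective \<Omega> p \<alpha> \<beta> F K \<mu> \<le> objective \<Omega> p \<alpha> \<beta> F K ?\<mu>t"
      using min by (auto simp: is_arg_min_def not_less)
    moreover have "K ?\<mu>t = K \<mu> + t *\<^sub>R K \<eta>"
      using K(1) \<mu> \<eta> smeasures_cmult[OF \<eta>] unfolding linear_on_smeasures_def by simp
    moreover have nonneg: "0 \<le> r + t * c"
    proof (cases "0 \<le> c")
      case False
      then have "t * c \<ge> 1 * c" using t by (intro mult_right_mono_neg) auto
      then show ?thesis using c by simp
    qed (use r t in simp)
    ultimately have "ereal (F (K \<mu>)) + ereal r
        \<le> ereal (F (K \<mu> + t *\<^sub>R K \<eta>)) + enn2ereal (KR_norm \<Omega> p \<alpha> \<beta> ?\<mu>t)"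
      unfolding objective_def using r by simp
    also have "enn2ereal (KR_norm \<Omega> p \<alpha> \<beta> ?\<mu>t) \<le> ereal (r + t * c)"
      using le[OF t] nonneg by (metis enn2ereal_ennreal less_eq_ennreal.rep_eq)
    finally have "F (K \<mu>) + r \<le> F (K \<mu> + t *\<^sub>R K \<eta>) + (r + t * c)"
      by (simp add: add_left_mono)
    then show ?thesis using t by (simp add: field_simps)
  qed
  then have "eventually (\<lambda>t. - c \<le> (F (K \<mu> + t *\<^sub>R K \<eta>) - F (K \<mu>)) / t) (at_right 0)"
    unfolding eventually_at_right_field by (intro exI[of _ 1]) auto
  then have "- c \<le> D \<bullet> K \<eta>"
    by (intro tendsto_lowerbound[OF GDERIV_directional[OF D]]) auto
  then show ?thesis
    using K(2) \<eta> by (simp add: pairing_uminus is_preadjoint_def)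
qed

text \<open>The gradient inequality for \<open>F\<close> at \<open>K \<mu>\<close> and the subgradient inequality at \<open>\<mu>\<close> add up: the
  linear terms cancel by the choice of the subgradient.\<close>

lemma subgradient_imp_arg_min:
  fixes K :: "'a::real_normed_vector smeasure \<Rightarrow> 'y::real_inner"
  assumes K: "linear_on_smeasures \<Omega> K" "is_preadjoint \<Omega> K Kpre"
    and F: "strictly_convex F" and D: "GDERIV F (K \<mu>) :> D"
    and r: "KR_norm \<Omega> p \<alpha> \<beta> \<mu> = ennreal r" "0 \<le> r" and \<mu>: "\<mu> \<in> smeasures \<Omega>"
    and sub: "(\<lambda>x. - Kpre D x) \<in> subdifferential \<Omega> (\<lambda>\<mu>. enn2ereal (KR_norm \<Omega> p \<alpha> \<beta> \<mu>)) \<mu>"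
  shows "is_arg_min (objective \<Omega> p \<alpha> \<beta> F K) (\<lambda>\<mu>. \<mu> \<in> smeasures \<Omega>) \<mu>"
proof -
  have "objective \<Omega> p \<alpha> \<beta> F K \<mu> \<le> objective \<Omega> p \<alpha> \<beta> F K \<eta>" if \<eta>: "\<eta> \<in> smeasures \<Omega>" for \<eta>
  proof -
    have diff: "(\<lambda>A. \<eta> A - \<mu> A) \<in> smeasures \<Omega>" by (rule smeasures_diff[OF \<eta> \<mu>])
    have pair: "pairing \<Omega> (\<lambda>x. - Kpre D x) (\<lambda>A. \<eta> A - \<mu> A) = - (D \<bullet> (K \<eta> - K \<mu>))"
      using K(2) diff linear_on_smeasures_diff[OF K(1) \<eta> \<mu>]
      by (simp add: pairing_uminus is_preadjoint_def)
    have "ereal r + ereal (- (D \<bullet> (K \<eta> - K \<mu>))) \<le> enn2ereal (KR_norm \<Omega> p \<alpha> \<beta> \<eta>)"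
      using sub \<eta> r unfolding subdifferential_def pair[symmetric] by auto
    moreover have "F (K \<mu>) + D \<bullet> (K \<eta> - K \<mu>) \<le> F (K \<eta>)"
      by (rule strictly_convex_gradient_le[OF F D])
    ultimately show ?thesis
      unfolding objective_def using r by (cases "enn2ereal (KR_norm \<Omega> p \<alpha> \<beta> \<eta>)") auto
  qed
  then show ?thesis using \<mu> by (auto simp: is_arg_min_def not_less)
qed

text \<open>Three kinds of directions are tested. The signed point masses \<open>\<plusminus>\<delta>\<^sub>x\<close> cost at most \<open>\<alpha>\<close> per unit
  and give the bound on \<open>q\<close>. The dipoles \<open>\<delta>\<^sub>x - \<delta>\<^sub>y\<close> cost \<open>\<bar>x - y\<bar>\<^sup>p + \<beta>\<close> per unit, first for points
  that are not atoms of \<open>\<nu>\<close>, and then for all points by density and continuity. The direction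
  \<open>- \<mu>\<close>, along which the whole plan is scaled down, gives the reverse of weak duality.\<close>

lemma arg_min_imp_dual_certificate:
  fixes \<Omega> :: "'a::euclidean_space set" and K :: "'a smeasure \<Rightarrow> 'y::real_inner"
  assumes \<Omega>: "convex \<Omega>" "compact \<Omega>" and p: "0 < p" and \<alpha>: "0 \<le> \<alpha>" and \<beta>: "0 \<le> \<beta>"
    and K: "linear_on_smeasures \<Omega> K" "is_preadjoint \<Omega> K Kpre" and D: "GDERIV F (K \<mu>) :> D"
    and \<nu>: "\<nu> \<in> smeasures \<Omega>" "\<nu> \<Omega> = 0"
    and \<gamma>: "\<gamma> \<in> couplings \<Omega> (pos_part \<Omega> \<nu>) (neg_part \<Omega> \<nu>)"
    and opt: "KR_norm \<Omega> p \<alpha> \<beta> \<mu> = plan_cost \<Omega> p \<alpha> \<beta> \<mu> \<nu> \<gamma>"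
    and r: "plan_cost \<Omega> p \<alpha> \<beta> \<mu> \<nu> \<gamma> = ennreal r" "0 \<le> r"
    and min: "is_arg_min (objective \<Omega> p \<alpha> \<beta> F K) (\<lambda>\<mu>. \<mu> \<in> smeasures \<Omega>) \<mu>"
  defines "q \<equiv> \<lambda>x. - Kpre D x"
  shows "\<And>x. x \<in> \<Omega> \<Longrightarrow> \<bar>q x\<bar> \<le> \<alpha>"
    and "\<And>x y. x \<in> \<Omega> \<Longrightarrow> y \<in> \<Omega> \<Longrightarrow> q x - q y \<le> norm (x - y) powr p + \<beta>"
    and "r \<le> pairing \<Omega> q \<mu>"
proof -
  have \<mu>: "\<mu> \<in> smeasures \<Omega>" using min by (simp add: is_arg_min_def)
  have q: "continuous_on \<Omega> q"
    using K(2) unfolding q_def is_preadjoint_def by (intro continuous_on_minus) blast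
  note descent = arg_min_pairing_le[OF min K D opt[unfolded r(1)] r(2), folded q_def]
  have unit: "pairing \<Omega> q \<eta> \<le> \<alpha>"
    if \<eta>: "\<eta> \<in> smeasures \<Omega>" and tv: "emeasure (total_var \<Omega> \<eta>) \<Omega> = 1" for \<eta>
  proof (rule descent)
    fix t :: real assume t: "0 < t" "t < 1"
    have "KR_norm \<Omega> p \<alpha> \<beta> (\<lambda>A. \<mu> A + t * \<eta> A) \<le> plan_cost \<Omega> p \<alpha> \<beta> (\<lambda>A. \<mu> A + t * \<eta> A) \<nu> \<gamma>"
      by (rule KR_norm_le_plan_cost[OF \<nu> \<gamma>])
    also have "\<dots> \<le> plan_cost \<Omega> p \<alpha> \<beta> \<mu> \<nu> \<gamma> + ennreal \<alpha> * emeasure (total_var \<Omega> (\<lambda>A. t * \<eta> A)) \<Omega>"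
      by (rule plan_cost_add_le[OF \<mu> \<nu>(1) smeasures_cmult[OF \<eta>]])
    also have "emeasure (total_var \<Omega> (\<lambda>A. t * \<eta> A)) \<Omega> = ennreal t"
      using total_var_cmult[OF \<eta>, of t \<Omega>] sets.top[of "borel_on \<Omega>"] t tv by simp
    also have "plan_cost \<Omega> p \<alpha> \<beta> \<mu> \<nu> \<gamma> + ennreal \<alpha> * ennreal t = ennreal (r + t * \<alpha>)"
      using r \<alpha> t by (simp add: ennreal_mult mult.commute)
    finally show "KR_norm \<Omega> p \<alpha> \<beta> (\<lambda>A. \<mu> A + t * \<eta> A) \<le> ennreal (r + t * \<alpha>)" .
  qed (use \<eta> \<alpha> r in auto)
  show "\<bar>q x\<bar> \<le> \<alpha>" if x: "x \<in> \<Omega>" for x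
  proof -
    have "q x \<le> \<alpha>"
      using unit[OF dirac_in_smeasures[OF x] total_var_dirac[OF x]] pairing_dirac[OF x q] by simp
    moreover have "emeasure (total_var \<Omega> (\<lambda>A. - dirac \<Omega> x A)) \<Omega> = 1"
      using total_var_uminus[of \<Omega> \<Omega>] sets.top[of "borel_on \<Omega>"] total_var_dirac[OF x] by simp
    then have "- q x \<le> \<alpha>"
      using unit[OF smeasures_uminus[OF dirac_in_smeasures[OF x]]] pairing_dirac[OF x q]
      by (simp add: pairing_uminus_measure)
    ultimately show ?thesis by simp
  qed
  have atomless: "q x - q y \<le> norm (x - y) powr p + \<beta>"
    if x: "x \<in> \<Omega>" "\<nu> {x} = 0" and y: "y \<in> \<Omega>" "\<nu> {y} = 0" for x y
  proof (cases "x = y")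
    case False
    let ?\<eta> = "\<lambda>A. dirac \<Omega> x A - dirac \<Omega> y A"
    let ?c = "norm (x - y) powr p + \<beta>"
    have \<eta>: "?\<eta> \<in> smeasures \<Omega>" by (intro smeasures_diff dirac_in_smeasures x y)
    have \<Omega>sets: "\<Omega> \<in> sets (borel_on \<Omega>)" using sets.top[of "borel_on \<Omega>"] by simp
    have "pairing \<Omega> q ?\<eta> \<le> ?c"
    proof (rule descent)
      fix t :: real assume t: "0 < t" "t < 1"
      let ?\<gamma>' = "sum_measure \<gamma> (scale_measure (ennreal t) (return (borel_on (\<Omega> \<times> \<Omega>)) (x, y)))"
      note dipole = plan_cost_add_dipole[OF p \<nu>(1) \<gamma> x y False less_imp_le[OF t(1)] \<beta>]
      have "KR_norm \<Omega> p \<alpha> \<beta> (\<lambda>A. \<mu> A + t * ?\<eta> A) \<le>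
        plan_cost \<Omega> p \<alpha> \<beta> (\<lambda>A. \<mu> A + t * ?\<eta> A) (\<lambda>A. \<nu> A + t * ?\<eta> A) ?\<gamma>'"
        using \<nu> x y \<Omega>sets
        by (intro KR_norm_le_plan_cost dipole smeasures_add smeasures_cmult \<eta>) (auto simp: dirac_apply)
      also have "\<dots> = ennreal (r + t * ?c)"
        unfolding dipole r using r(2) t \<beta> by simp
      finally show "KR_norm \<Omega> p \<alpha> \<beta> (\<lambda>A. \<mu> A + t * ?\<eta> A) \<le> ennreal (r + t * ?c)" .
    next
      show "- r \<le> ?c" using r(2) \<beta> powr_ge_zero[of "norm (x - y)" p] by linarith
    qed (rule \<eta>)
    moreover have "pairing \<Omega> q ?\<eta> = q x - q y"
      using pairing_preadjoint_diff[OF K dirac_in_smeasures dirac_in_smeasures, of x y D] x y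
        pairing_dirac[OF _ q] unfolding q_def by simp
    ultimately show ?thesis by simp
  qed (use \<beta> in simp)
  show "q x - q y \<le> norm (x - y) powr p + \<beta>" if x: "x \<in> \<Omega>" and y: "y \<in> \<Omega>" for x y
  proof (cases "x = y")
    case False
    let ?s = "\<lambda>(x, y). norm (x - y) powr p + \<beta> - (q x - q y)"
    define E where "E = \<Omega> - {x. \<nu> {x} \<noteq> 0}"
    have "\<Omega> \<subseteq> closure E"
      unfolding E_def by (rule convex_closure_minus_countable[OF \<Omega>(1) x y False countable_atoms[OF \<nu>(1)]])
    moreover have "closure E \<subseteq> \<Omega>"
      using \<Omega>(2) by (intro closure_minimal compact_imp_closed) (auto simp: E_def)
    ultimately have cl: "closure (E \<times> E) = \<Omega> \<times> \<Omega>" by (simp add: closure_Times subset_antisym)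
    have "0 \<le> ?s (x, y)"
    proof (rule continuous_ge_on_closure[of "E \<times> E" ?s])
      show "continuous_on (closure (E \<times> E)) ?s" unfolding cl by (rule continuous_on_slack[OF p q])
    qed (use x y cl atomless in \<open>auto simp: E_def\<close>)
    then show ?thesis by simp
  qed (use \<beta> in simp)
  have "pairing \<Omega> q (\<lambda>A. - \<mu> A) \<le> - r"
  proof (rule descent)
    fix t :: real assume t: "0 < t" "t < 1"
    \<comment> \<open>Scaling the optimal plan by \<open>1 - t\<close> scales its cost, which is why \<open>c = - r\<close> is admissible.\<close>
    have eq: "(\<lambda>A. \<mu> A + t * - \<mu> A) = (\<lambda>A. (1 - t) * \<mu> A)" by (auto simp: algebra_simps)
    note scale = plan_cost_scale[OF p \<mu> \<nu>(1) \<gamma>, of "1 - t"]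
    have "KR_norm \<Omega> p \<alpha> \<beta> (\<lambda>A. (1 - t) * \<mu> A) \<le> plan_cost \<Omega> p \<alpha> \<beta> (\<lambda>A. (1 - t) * \<mu> A)
        (\<lambda>A. (1 - t) * \<nu> A) (scale_measure (ennreal (1 - t)) \<gamma>)"
      using \<nu> t by (intro KR_norm_le_plan_cost scale smeasures_cmult) auto
    also have "\<dots> = ennreal (1 - t) * ennreal r"
      using scale(2) t r by simp
    also have "\<dots> = ennreal (r + t * - r)"
      using t r by (simp add: ennreal_mult[symmetric] algebra_simps)
    finally show "KR_norm \<Omega> p \<alpha> \<beta> (\<lambda>A. \<mu> A + t * - \<mu> A) \<le> ennreal (r + t * - r)"
      unfolding eq .
  qed (use smeasures_uminus[OF \<mu>] in auto)
  then show "r \<le> pairing \<Omega> q \<mu>" by (simp add: pairing_uminus_measure)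
qed

section \<open>The optimality conditions\<close>

theorem theorem3p2:
  fixes \<Omega> :: "(real ^ 'n) set"
    and p \<alpha> \<beta> :: real
    and K :: "(real ^ 'n) smeasure \<Rightarrow> 'y::{real_inner, complete_space}"
    and Kpre :: "'y \<Rightarrow> (real ^ 'n) \<Rightarrow> real"
    and F :: "'y \<Rightarrow> real"
    and gradF :: "'y \<Rightarrow> 'y"
    and \<mu>bar \<nu>bar :: "(real ^ 'n) smeasure"
    and \<gamma>bar :: "((real ^ 'n) \<times> (real ^ 'n)) measure"
    and qbar :: "(real ^ 'n) \<Rightarrow> real"
  assumes "convex \<Omega>" and "compact \<Omega>"
    and "0 < p" and "p \<le> 1"
    and "\<alpha> > 0" and "\<beta> > 0" and "2 * \<alpha> - \<beta> > 0"
    and "linear_on_smeasures \<Omega> K"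
    and "continuous_map (weak_star \<Omega>) euclidean K"
    and "is_preadjoint \<Omega> K Kpre"
    and "strictly_convex F"
    and "\<And>v. GDERIV F v :> gradF v"
    and "\<And>S. compact S \<Longrightarrow> \<exists>L. L-lipschitz_on S gradF"
    and "\<mu>bar \<in> smeasures \<Omega>"
    and "\<nu>bar \<in> smeasures \<Omega>" and "\<nu>bar \<Omega> = 0"
    and "\<gamma>bar \<in> couplings \<Omega> (pos_part \<Omega> \<nu>bar) (neg_part \<Omega> \<nu>bar)"
    and "KR_norm \<Omega> p \<alpha> \<beta> \<mu>bar =
           Wp_beta \<Omega> p \<beta> \<nu>bar + ennreal \<alpha> * emeasure (total_var \<Omega> (\<lambda>A. \<mu>bar A - \<nu>bar A)) \<Omega>"
    and "Wp \<Omega> p (pos_part \<Omega> \<nu>bar) (neg_part \<Omega> \<nu>bar) = transport_cost p \<gamma>bar"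
    and "qbar = (\<lambda>x. - Kpre (gradF (K \<mu>bar)) x)"
  shows
    "(is_arg_min (objective \<Omega> p \<alpha> \<beta> F K) (\<lambda>\<mu>. \<mu> \<in> smeasures \<Omega>) \<mu>bar \<longleftrightarrow>
        qbar \<in> subdifferential \<Omega> (\<lambda>\<mu>. enn2ereal (KR_norm \<Omega> p \<alpha> \<beta> \<mu>)) \<mu>bar) \<and>
     (qbar \<in> subdifferential \<Omega> (\<lambda>\<mu>. enn2ereal (KR_norm \<Omega> p \<alpha> \<beta> \<mu>)) \<mu>bar \<longleftrightarrow>
        (\<forall>x\<in>\<Omega>. \<bar>qbar x\<bar> \<le> \<alpha>) \<and>
        (\<forall>x\<in>\<Omega>. \<forall>y\<in>\<Omega>. Psi p \<beta> qbar x y \<le> 1) \<and>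
        msupp (pos_part \<Omega> (\<lambda>A. \<mu>bar A - \<nu>bar A)) \<subseteq> {x \<in> \<Omega>. qbar x = \<alpha>} \<and>
        msupp (neg_part \<Omega> (\<lambda>A. \<mu>bar A - \<nu>bar A)) \<subseteq> {x \<in> \<Omega>. qbar x = - \<alpha>} \<and>
        msupp \<gamma>bar \<subseteq> {(x, y) \<in> \<Omega> \<times> \<Omega>. Psi p \<beta> qbar x y = 1})"
proof -
  note \<Omega> = \<open>convex \<Omega>\<close> \<open>compact \<Omega>\<close> and p = \<open>0 < p\<close>
  have \<alpha>: "0 \<le> \<alpha>" and \<beta>: "0 \<le> \<beta>" using \<open>\<alpha> > 0\<close> \<open>\<beta> > 0\<close> by simp_all
  note K = \<open>linear_on_smeasures \<Omega> K\<close> \<open>is_preadjoint \<Omega> K Kpre\<close>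
  note \<mu> = \<open>\<mu>bar \<in> smeasures \<Omega>\<close> and \<nu> = \<open>\<nu>bar \<in> smeasures \<Omega>\<close> \<open>\<nu>bar \<Omega> = 0\<close>
  note \<gamma> = \<open>\<gamma>bar \<in> couplings \<Omega> (pos_part \<Omega> \<nu>bar) (neg_part \<Omega> \<nu>bar)\<close>
  have D: "GDERIV F (K \<mu>bar) :> gradF (K \<mu>bar)" by fact
  note q_def = \<open>qbar = (\<lambda>x. - Kpre (gradF (K \<mu>bar)) x)\<close>
  have q: "continuous_on \<Omega> qbar"
    using K(2) unfolding q_def is_preadjoint_def by (intro continuous_on_minus) blast
  have opt: "KR_norm \<Omega> p \<alpha> \<beta> \<mu>bar = plan_cost \<Omega> p \<alpha> \<beta> \<mu>bar \<nu>bar \<gamma>bar"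
    using \<open>KR_norm \<Omega> p \<alpha> \<beta> \<mu>bar = _\<close> \<open>Wp \<Omega> p (pos_part \<Omega> \<nu>bar) (neg_part \<Omega> \<nu>bar) = _\<close> \<nu>(2)
    by (simp add: plan_cost_def Wp_beta_def couplings_total_var[OF \<gamma>])
  obtain r where r: "plan_cost \<Omega> p \<alpha> \<beta> \<mu>bar \<nu>bar \<gamma>bar = ennreal r" "0 \<le> r"
    using plan_cost_eq[OF \<Omega>(2) p \<alpha> \<beta> \<mu> \<nu>(1) \<gamma> q] by blast
  have split: "pairing \<Omega> qbar \<nu> + pairing \<Omega> qbar (\<lambda>A. \<mu> A - \<nu> A) = pairing \<Omega> qbar \<mu>"
    if "\<mu> \<in> smeasures \<Omega>" "\<nu> \<in> smeasures \<Omega>" for \<mu> \<nu>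
    unfolding q_def using pairing_preadjoint_diff[OF K that] by simp
  let ?sub = "qbar \<in> subdifferential \<Omega> (\<lambda>\<mu>. enn2ereal (KR_norm \<Omega> p \<alpha> \<beta> \<mu>)) \<mu>bar"
  let ?min = "is_arg_min (objective \<Omega> p \<alpha> \<beta> F K) (\<lambda>\<mu>. \<mu> \<in> smeasures \<Omega>) \<mu>bar"
  let ?bound = "\<forall>x\<in>\<Omega>. \<bar>qbar x\<bar> \<le> \<alpha>"
  let ?lip = "\<forall>x\<in>\<Omega>. \<forall>y\<in>\<Omega>. Psi p \<beta> qbar x y \<le> 1"
  let ?supp = "msupp (pos_part \<Omega> (\<lambda>A. \<mu>bar A - \<nu>bar A)) \<subseteq> {x \<in> \<Omega>. qbar x = \<alpha>} \<and>
        msupp (neg_part \<Omega> (\<lambda>A. \<mu>bar A - \<nu>bar A)) \<subseteq> {x \<in> \<Omega>. qbar x = - \<alpha>} \<and>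
        msupp \<gamma>bar \<subseteq> {(x, y) \<in> \<Omega> \<times> \<Omega>. Psi p \<beta> qbar x y = 1}"
  have denom: "norm (x - y) powr p + \<beta> > 0" for x y :: "real ^ 'n"
    using \<open>\<beta> > 0\<close> by (simp add: add_nonneg_pos)
  have Psi_le: "Psi p \<beta> qbar x y \<le> 1 \<longleftrightarrow> qbar x - qbar y \<le> norm (x - y) powr p + \<beta>"
    and Psi_eq: "Psi p \<beta> qbar x y = 1 \<longleftrightarrow> qbar x - qbar y = norm (x - y) powr p + \<beta>" for x y
    using denom[of x y] by (auto simp: Psi_def field_simps)
  have tight: "r \<le> pairing \<Omega> qbar \<mu>bar \<longleftrightarrow> ?supp" and upper: "pairing \<Omega> qbar \<mu>bar \<le> r"
    if ?bound ?lip
    using plan_cost_duality(2,3)[OF \<Omega>(2) p \<alpha> \<beta> \<mu> \<nu>(1) \<gamma> q _ _ r] that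
    unfolding split[OF \<mu> \<nu>(1)] Psi_le Psi_eq by auto
  \<comment> \<open>The equivalences follow from a cycle: subgradient, minimiser, certificate, subgradient.\<close>
  have sub_min: "?min" if ?sub
    using subgradient_imp_arg_min[OF K \<open>strictly_convex F\<close> D opt[unfolded r(1)] r(2) \<mu>] that
    unfolding q_def by blast
  have min_cert: "?bound \<and> ?lip \<and> ?supp" if ?min
  proof -
    note cert = arg_min_imp_dual_certificate[OF \<Omega> p \<alpha> \<beta> K D \<nu> \<gamma> opt r that, folded q_def]
    have bl: ?bound ?lip using cert(1,2) unfolding Psi_le unfolding q_def by blast+
    then show ?thesis using tight[OF bl] cert(3) by blast
  qed
  have cert_sub: ?sub if "?bound \<and> ?lip \<and> ?supp"
  proof -
    from that have bl: ?bound ?lip and supp: ?supp by blast+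
    have r_eq: "r = pairing \<Omega> qbar \<mu>bar"
      using tight[OF bl] upper[OF bl] supp by (intro antisym) blast+
    have lower: "ennreal (pairing \<Omega> qbar \<eta>) \<le> KR_norm \<Omega> p \<alpha> \<beta> \<eta>" if \<eta>: "\<eta> \<in> smeasures \<Omega>" for \<eta>
    proof (rule KR_norm_greatest)
      fix \<nu> \<gamma> assume \<nu>: "\<nu> \<in> smeasures \<Omega>" and \<gamma>: "\<gamma> \<in> couplings \<Omega> (pos_part \<Omega> \<nu>) (neg_part \<Omega> \<nu>)"
      show "ennreal (pairing \<Omega> qbar \<eta>) \<le> plan_cost \<Omega> p \<alpha> \<beta> \<eta> \<nu> \<gamma>"
        using plan_cost_duality(1)[OF \<Omega>(2) p \<alpha> \<beta> \<eta> \<nu> \<gamma> q] bl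
        unfolding split[OF \<eta> \<nu>] Psi_le by blast
    qed
    have "enn2ereal (KR_norm \<Omega> p \<alpha> \<beta> \<mu>bar) + ereal (pairing \<Omega> qbar (\<lambda>A. \<eta> A - \<mu>bar A))
      \<le> enn2ereal (KR_norm \<Omega> p \<alpha> \<beta> \<eta>)" if \<eta>: "\<eta> \<in> smeasures \<Omega>" for \<eta>
    proof -
      have "enn2ereal (KR_norm \<Omega> p \<alpha> \<beta> \<mu>bar) + ereal (pairing \<Omega> qbar (\<lambda>A. \<eta> A - \<mu>bar A))
        = ereal (pairing \<Omega> qbar \<eta>)"
        using split[OF \<eta> \<mu>] r(2) by (simp add: opt r(1) r_eq[symmetric]) 
      also have "\<dots> \<le> enn2ereal (ennreal (pairing \<Omega> qbar \<eta>))"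
        by (simp add: ennreal.rep_eq)
      also have "\<dots> \<le> enn2ereal (KR_norm \<Omega> p \<alpha> \<beta> \<eta>)"
        using lower[OF \<eta>] by (simp add: less_eq_ennreal.rep_eq)
      finally show ?thesis .
    qed
    then show ?thesis using q by (simp add: subdifferential_def)
  qed
  show ?thesis using sub_min min_cert cert_sub by blast
qed

end
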